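(* Let $p,q$ be positive integers. (1) Let $E : \mathrm{L}(\mathbb{C}^p) \to \mathrm{L}(\mathbb{C}^q)$ be a completely positive (CP) linear map. Then $E$ has a CP inverse $D : \mathrm{L}(\mathbb{C}^q) \to \mathrm{L}(\mathbb{C}^p)$ if and only if there exist a positive semi-definite operator $Q \in \mathrm{L}(\mathbb{C}^q)$ and a real number $c > 0$ such that for all density matrices $\rho,\sigma \in \mathrm{L}(\mathbb{C}^p)$, $$\mathrm{Tr}\big(Q\, E(\rho)\, Q\, E(\sigma)\big) = c \cdot \mathrm{Tr}(\rho\sigma).$$ (2) Let $E : \mathrm{L}(\mathbb{C}^p) \to \mathrm{L}(\mathbb{C}^q)$ be a completely positive trace preserving (CPTP) linear map. Then $E$ has a CPTP inverse $D : \mathrm{L}(\mathbb{C}^q) \to \mathrm{L}(\mathbb{C}^p)$ if and only if the condition in (1) holds with $Q$ equal to the identity operator on $\mathbb{C}^q$, i.e., if and only if there exists a real number $c>0$ such that $\mathrm{Tr}(E(\rho)E(\sigma)) = c\cdot \mathrm{Tr}(\rho\sigma)$ for all density matrices $\rho,\sigma\in \mathrm{L}(\mathbb{C}^p)$.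
   Context: $\mathrm{L}(\mathcal{H})$ denotes the space of linear operators on the (finite-dimensional, complex) Hilbert space $\mathcal{H}$. A density matrix is a positive semi-definite operator of trace $1$. An inverse of $E : \mathrm{L}(\mathbb{C}^p) \to \mathrm{L}(\mathbb{C}^q)$ means a linear map $D : \mathrm{L}(\mathbb{C}^q) \to \mathrm{L}(\mathbb{C}^p)$ with $D(E(\rho)) = \rho$ for every density matrix $\rho \in \mathrm{L}(\mathbb{C}^p)$ (a left inverse); it is a CP (respectively CPTP) inverse if $D$ is CP (respectively CPTP). *)

theory Defs
  imports "Jordan_Normal_Form.Schur_Decomposition"
begin

text \<open>Operators on the Hilbert space $C^d$ are the matrices in \<open>carrier_mat d d\<close>; a
  (super)operator from $L(C^p)$ to $L(C^q)$ is a HOL function of which only the values on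
  \<open>carrier_mat p p\<close> matter.\<close>

definition trace_mat :: "complex mat \<Rightarrow> complex" where
  "trace_mat A = (\<Sum>i<dim_row A. A $$ (i, i))"

text \<open>The order on the complex numbers is that of \<open>HOL-Library.Complex_Order\<close>: \<open>0 \<le> z\<close> says that
  \<open>z\<close> is real and nonnegative. Over the complex field this forces \<open>A\<close> to be Hermitian.\<close>

definition psd :: "nat \<Rightarrow> complex mat \<Rightarrow> bool" where
  "psd d A \<longleftrightarrow> A \<in> carrier_mat d d \<and> (\<forall>v \<in> carrier_vec d. 0 \<le> (A *\<^sub>v v) \<bullet>c v)"

definition density_matrix :: "nat \<Rightarrow> complex mat \<Rightarrow> bool" where
  "density_matrix d \<rho> \<longleftrightarrow> psd d \<rho> \<and> trace_mat \<rho> = 1"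

definition linear_superop :: "nat \<Rightarrow> nat \<Rightarrow> (complex mat \<Rightarrow> complex mat) \<Rightarrow> bool" where
  "linear_superop p q E \<longleftrightarrow>
     E \<in> LinearCombinations.module_hom class_ring (module_mat TYPE(complex) p p) (module_mat TYPE(complex) q q)"

text \<open>\<open>ampliation n p q E\<close> is $id_n \otimes E$, where $C^n \otimes C^d$ is identified with
  $C^{nd}$ by sending $e_a \otimes e_k$ to $e_{ad+k}$. A matrix on $C^n \otimes C^p$ is
  then an \<open>n\<close> by \<open>n\<close> array of \<open>p\<close> by \<open>p\<close> blocks, and \<open>E\<close> is applied to each block.\<close>

definition ampliation ::
  "nat \<Rightarrow> nat \<Rightarrow> nat \<Rightarrow> (complex mat \<Rightarrow> complex mat) \<Rightarrow> complex mat \<Rightarrow> complex mat" where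
  "ampliation n p q E X = mat (n * q) (n * q) (\<lambda>(i, j).
     E (mat p p (\<lambda>(k, l). X $$ ((i div q) * p + k, (j div q) * p + l))) $$ (i mod q, j mod q))"

definition completely_positive :: "nat \<Rightarrow> nat \<Rightarrow> (complex mat \<Rightarrow> complex mat) \<Rightarrow> bool" where
  "completely_positive p q E \<longleftrightarrow> linear_superop p q E \<and>
     (\<forall>n X. psd (n * p) X \<longrightarrow> psd (n * q) (ampliation n p q E X))"

definition trace_preserving :: "nat \<Rightarrow> (complex mat \<Rightarrow> complex mat) \<Rightarrow> bool" where
  "trace_preserving p E \<longleftrightarrow> (\<forall>X \<in> carrier_mat p p. trace_mat (E X) = trace_mat X)"

definition cptp :: "nat \<Rightarrow> nat \<Rightarrow> (complex mat \<Rightarrow> complex mat) \<Rightarrow> bool" where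
  "cptp p q E \<longleftrightarrow> completely_positive p q E \<and> trace_preserving p E"

definition inverts :: "nat \<Rightarrow> (complex mat \<Rightarrow> complex mat) \<Rightarrow> (complex mat \<Rightarrow> complex mat) \<Rightarrow> bool" where
  "inverts p D E \<longleftrightarrow> (\<forall>\<rho>. density_matrix p \<rho> \<longrightarrow> D (E \<rho>) = \<rho>)"

text \<open>Sanity check: \<open>ampliation\<close> acts on elementary tensors as $id_n \otimes E$ should.\<close>

definition kronecker :: "complex mat \<Rightarrow> complex mat \<Rightarrow> complex mat" where
  "kronecker A B = mat (dim_row A * dim_row B) (dim_col A * dim_col B) (\<lambda>(i, j).
     A $$ (i div dim_row B, j div dim_col B) * B $$ (i mod dim_row B, j mod dim_col B))"

lemma ampliation_kronecker:
  assumes E: "linear_superop p q E" and A: "A \<in> carrier_mat n n" and B: "B \<in> carrier_mat p p"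
  shows "ampliation n p q E (kronecker A B) = kronecker A (E B)"
proof -
  have EB: "E B \<in> carrier_mat q q"
    using E B by (auto simp: linear_superop_def LinearCombinations.module_hom_def module_mat_simps)
  have hom: "E (c \<cdot>\<^sub>m B) = c \<cdot>\<^sub>m E B" for c
    using E B by (auto simp: linear_superop_def LinearCombinations.module_hom_def module_mat_simps)
  have idx: "a * p + k < n * p" if "a < n" "k < p" for a k
  proof -
    have "a * p + k < Suc a * p" using that by simp
    also have "\<dots> \<le> n * p" using that by (intro mult_le_mono1) simp
    finally show ?thesis .
  qed
  have block: "mat p p (\<lambda>(k, l). kronecker A B $$ (a * p + k, b * p + l)) = A $$ (a, b) \<cdot>\<^sub>m B"
    if "a < n" "b < n" for a b
    using that A B idx by (intro eq_matI) (auto simp: kronecker_def)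
  show ?thesis
  proof (rule eq_matI)
    fix i j
    assume "i < dim_row (kronecker A (E B))" "j < dim_col (kronecker A (E B))"
    then have ij: "i < n * q" "j < n * q" using A EB by (auto simp: kronecker_def)
    then have q: "q > 0" by (cases q) auto
    have ab: "i div q < n" "j div q < n" using ij by (auto simp: less_mult_imp_div_less)
    have "ampliation n p q E (kronecker A B) $$ (i, j) =
        E (A $$ (i div q, j div q) \<cdot>\<^sub>m B) $$ (i mod q, j mod q)"
      using ij by (simp add: ampliation_def block[OF ab])
    also have "\<dots> = kronecker A (E B) $$ (i, j)"
      using ij q A EB by (simp add: kronecker_def hom)
    finally show "ampliation n p q E (kronecker A B) $$ (i, j) = kronecker A (E B) $$ (i, j)" .
  qed (use A EB in \<open>auto simp: ampliation_def kronecker_def\<close>)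
qed

end

(* Represent E by Kraus operators K s. If D with Kraus operators L t inverts E, the products L t * K s
   form a Kraus family of the identity, so they are scalar multiples of the identity. With
   Q = D^*(1) this makes all K u^* Q K s scalar, which is the trace condition; D is trace preserving
   iff Q = 1. Conversely the trace condition says that Y |-> E^*(Q Y Q) / c inverts E. For Q = 1 this
   inverse need not be trace preserving, but its existence makes all K u^* K s scalar, and
   Gram-Schmidt then yields isometries U a with orthogonal ranges spanning the K s. Undoing these
   isometries and resetting the orthogonal complement of their ranges to a fixed state is a trace
   preserving inverse. *)

theory Submission
  imports Defs
begin

section \<open>Matrix sums, adjoints and traces\<close>

text \<open>The trace condition gets its constant from the numbers g(u,s) with K_u^* Q K_s = g(u,s)
  1: it is the sum of all |g(u,s)|^2. The choice Q = D^*(1) works because K_u^* Q K_s is then the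
  sum over t of the products of the adjoint of L_t K_u with L_t K_s, in which every factor is
  scalar. The obstacle in the CPTP half is that E^* / c is trace preserving only if E(1) = c 1,
  which already fails for an isometric embedding into a larger space. Gram-Schmidt applies to
  operators because scalar products K_s^* K_t behave like a complex-valued inner product, so one
  projects and normalises as with vectors. The weight of the recovered state is never computed: all
  products of a recovery operator with a K_s are scalar, so recovery after E is w times the identity
  map, and trace preservation of both maps forces w = 1.\<close>

text \<open>Matrices of all sizes share one type, so the dimensions are parameters; they fix the
  size of the empty sum.\<close>

definition mat_sum :: "nat \<Rightarrow> nat \<Rightarrow> ('s \<Rightarrow> complex mat) \<Rightarrow> 's set \<Rightarrow> complex mat" where
  "mat_sum m n F S = mat m n (\<lambda>(i, j). \<Sum>s\<in>S. F s $$ (i, j))"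

lemma dim_mat_sum [simp]:
  "dim_row (mat_sum m n F S) = m" "dim_col (mat_sum m n F S) = n"
  "mat_sum m n F S \<in> carrier_mat m n"
  by (auto simp: mat_sum_def)

lemma dim_mat_adjoint [simp]:
  "dim_row (mat_adjoint A) = dim_col A" "dim_col (mat_adjoint A) = dim_row A"
  by (simp_all add: mat_adjoint_def)

lemma mat_adjoint_carrier [simp]:
  "mat_adjoint A \<in> carrier_mat n m \<longleftrightarrow> A \<in> carrier_mat m n"
  by (metis carrier_matD carrier_matI dim_mat_adjoint)

lemma index_mat_adjoint [simp]:
  fixes A :: "complex mat"
  shows "i < dim_col A \<Longrightarrow> j < dim_row A \<Longrightarrow> mat_adjoint A $$ (i, j) = cnj (A $$ (j, i))"
  by (simp add: mat_adjoint_def mat_of_rows_index conjugate_complex_def)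

lemma index_mult_sum:
  fixes A B :: "'a :: comm_semiring_0 mat"
  shows "i < dim_row A \<Longrightarrow> j < dim_col B \<Longrightarrow> dim_col A = dim_row B \<Longrightarrow>
    (A * B) $$ (i, j) = (\<Sum>k<dim_row B. A $$ (i, k) * B $$ (k, j))"
  by (simp add: scalar_prod_def atLeast0LessThan)

lemma mat_mult_assoc:
  fixes A B C :: "complex mat"
  shows "dim_col A = dim_row B \<Longrightarrow> dim_col B = dim_row C \<Longrightarrow> A * B * C = A * (B * C)"
  by (rule assoc_mult_mat[of A "dim_row A" "dim_row B" B "dim_row C" C "dim_col C"]) auto

lemma mat_adjoint_adjoint [simp]:
  fixes A :: "complex mat"
  shows "mat_adjoint (mat_adjoint A) = A"
  by (rule eq_matI) auto

lemma mat_adjoint_mult: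
  fixes A B :: "complex mat"
  shows "dim_col A = dim_row B \<Longrightarrow> mat_adjoint (A * B) = mat_adjoint B * mat_adjoint A"
  by (rule eq_matI) (auto simp: index_mult_sum mult.commute simp del: index_mult_mat(1))

lemma mat_adjoint_one [simp]: "mat_adjoint (1\<^sub>m n :: complex mat) = 1\<^sub>m n"
  by (rule eq_matI) auto

lemma mat_adjoint_smult:
  fixes A :: "complex mat"
  shows "mat_adjoint (c \<cdot>\<^sub>m A) = cnj c \<cdot>\<^sub>m mat_adjoint A"
  by (rule eq_matI) auto

lemma mat_adjoint_minus:
  fixes A B :: "complex mat"
  shows "dim_row A = dim_row B \<Longrightarrow> dim_col A = dim_col B \<Longrightarrow>
    mat_adjoint (A - B) = mat_adjoint A - mat_adjoint B"
  by (rule eq_matI) auto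

lemma mat_adjoint_mat_sum:
  assumes "\<And>s. s \<in> S \<Longrightarrow> F s \<in> carrier_mat m n"
  shows "mat_adjoint (mat_sum m n F S) = mat_sum n m (\<lambda>s. mat_adjoint (F s)) S"
proof (rule eq_matI)
  fix i j assume "i < dim_row (mat_sum n m (\<lambda>s. mat_adjoint (F s)) S)"
    "j < dim_col (mat_sum n m (\<lambda>s. mat_adjoint (F s)) S)"
  then have "i < n" "j < m" by auto
  then show "mat_adjoint (mat_sum m n F S) $$ (i, j) = mat_sum n m (\<lambda>s. mat_adjoint (F s)) S $$ (i, j)"
    using carrier_matD[OF assms] by (auto simp: mat_sum_def intro!: sum.cong)
qed auto

lemma mat_mult_smult:
  fixes A B :: "complex mat"
  shows "dim_col A = dim_row B \<Longrightarrow> A * (c \<cdot>\<^sub>m B) = c \<cdot>\<^sub>m (A * B)"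
    "dim_col A = dim_row B \<Longrightarrow> (c \<cdot>\<^sub>m A) * B = c \<cdot>\<^sub>m (A * B)"
  by (rule eq_matI; simp add: scalar_prod_def sum_distrib_left mult_ac)+

lemma smult_smult_mat:
  fixes A :: "complex mat"
  shows "c \<cdot>\<^sub>m (d \<cdot>\<^sub>m A) = (c * d) \<cdot>\<^sub>m A"
  by (rule eq_matI) simp_all

lemma mat_mult_minus:
  fixes A B C :: "complex mat"
  shows "dim_col A = dim_row B \<Longrightarrow> dim_row C = dim_row B \<Longrightarrow> dim_col C = dim_col B \<Longrightarrow>
      A * (B - C) = A * B - A * C"
    "dim_col A = dim_row C \<Longrightarrow> dim_row A = dim_row B \<Longrightarrow> dim_col A = dim_col B \<Longrightarrow>
      (A - B) * C = A * C - B * C"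
  by (rule mult_minus_distrib_mat[of A "dim_row A" "dim_row B" B "dim_col B" C]; auto)
    (rule minus_mult_distrib_mat[of A "dim_row A" "dim_row C" B C "dim_col C"]; auto)

lemma mat_mult_one:
  fixes A :: "complex mat"
  shows "dim_row A = n \<Longrightarrow> 1\<^sub>m n * A = A" "dim_col A = n \<Longrightarrow> A * 1\<^sub>m n = A"
  by auto

lemma mat_mult_mat_sum:
  assumes "A \<in> carrier_mat k m" "\<And>s. s \<in> S \<Longrightarrow> F s \<in> carrier_mat m n"
  shows "A * mat_sum m n F S = mat_sum k n (\<lambda>s. A * F s) S"
proof (rule eq_matI)
  fix i j assume "i < dim_row (mat_sum k n (\<lambda>s. A * F s) S)"
    "j < dim_col (mat_sum k n (\<lambda>s. A * F s) S)"
  then have ij: "i < k" "j < n" by auto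
  have "(A * mat_sum m n F S) $$ (i, j) = (\<Sum>l<m. \<Sum>s\<in>S. A $$ (i, l) * F s $$ (l, j))"
    using ij carrier_matD[OF assms(1)] carrier_matD[OF assms(2)]
    by (simp add: index_mult_sum mat_sum_def sum_distrib_left del: index_mult_mat(1))
  also have "\<dots> = (\<Sum>s\<in>S. \<Sum>l<m. A $$ (i, l) * F s $$ (l, j))"
    by (rule sum.swap)
  also have "\<dots> = mat_sum k n (\<lambda>s. A * F s) S $$ (i, j)"
    using ij carrier_matD[OF assms(1)] carrier_matD[OF assms(2)]
    by (simp add: mat_sum_def index_mult_sum del: index_mult_mat(1))
  finally show "(A * mat_sum m n F S) $$ (i, j) = mat_sum k n (\<lambda>s. A * F s) S $$ (i, j)" .
qed (use assms in auto)

lemma mat_sum_mult: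
  assumes "A \<in> carrier_mat n k" "\<And>s. s \<in> S \<Longrightarrow> F s \<in> carrier_mat m n"
  shows "mat_sum m n F S * A = mat_sum m k (\<lambda>s. F s * A) S"
proof (rule eq_matI)
  fix i j assume "i < dim_row (mat_sum m k (\<lambda>s. F s * A) S)"
    "j < dim_col (mat_sum m k (\<lambda>s. F s * A) S)"
  then have ij: "i < m" "j < k" by auto
  have "(mat_sum m n F S * A) $$ (i, j) = (\<Sum>l<n. \<Sum>s\<in>S. F s $$ (i, l) * A $$ (l, j))"
    using ij carrier_matD[OF assms(1)] carrier_matD[OF assms(2)]
    by (simp add: index_mult_sum mat_sum_def sum_distrib_right del: index_mult_mat(1))
  also have "\<dots> = (\<Sum>s\<in>S. \<Sum>l<n. F s $$ (i, l) * A $$ (l, j))"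
    by (rule sum.swap)
  also have "\<dots> = mat_sum m k (\<lambda>s. F s * A) S $$ (i, j)"
    using ij carrier_matD[OF assms(1)] carrier_matD[OF assms(2)]
    by (simp add: mat_sum_def index_mult_sum del: index_mult_mat(1))
  finally show "(mat_sum m n F S * A) $$ (i, j) = mat_sum m k (\<lambda>s. F s * A) S $$ (i, j)" .
qed (use assms in auto)

lemma mat_sum_cong:
  assumes "\<And>s. s \<in> S \<Longrightarrow> F s = G s"
  shows "mat_sum m n F S = mat_sum m n G S"
  using assms by (auto simp: mat_sum_def intro!: eq_matI sum.cong)

lemma mat_sum_scalar:
  assumes "A \<in> carrier_mat m n"
  shows "mat_sum m n (\<lambda>s. c s \<cdot>\<^sub>m A) S = (\<Sum>s\<in>S. c s) \<cdot>\<^sub>m A"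
  using assms by (auto simp: mat_sum_def sum_distrib_right intro!: eq_matI)

lemma smult_mat_sum:
  assumes "\<And>s. s \<in> S \<Longrightarrow> F s \<in> carrier_mat m n"
  shows "c \<cdot>\<^sub>m mat_sum m n F S = mat_sum m n (\<lambda>s. c \<cdot>\<^sub>m F s) S"
  using carrier_matD[OF assms] by (intro eq_matI) (auto simp: mat_sum_def sum_distrib_left intro!: sum.cong)

lemma trace_mat_mat_sum:
  assumes "\<And>s. s \<in> S \<Longrightarrow> F s \<in> carrier_mat m m"
  shows "trace_mat (mat_sum m m F S) = (\<Sum>s\<in>S. trace_mat (F s))"
proof -
  have "trace_mat (mat_sum m m F S) = (\<Sum>i<m. \<Sum>s\<in>S. F s $$ (i, i))"
    by (simp add: trace_mat_def mat_sum_def)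
  also have "\<dots> = (\<Sum>s\<in>S. \<Sum>i<m. F s $$ (i, i))"
    by (rule sum.swap)
  also have "\<dots> = (\<Sum>s\<in>S. trace_mat (F s))"
    using carrier_matD[OF assms] by (intro sum.cong) (auto simp: trace_mat_def)
  finally show ?thesis .
qed

lemma trace_mat_comm:
  assumes "dim_col A = dim_row B" "dim_col B = dim_row A"
  shows "trace_mat (A * B) = trace_mat (B * A)"
proof -
  have "trace_mat (A * B) = (\<Sum>i<dim_row A. \<Sum>k<dim_row B. A $$ (i, k) * B $$ (k, i))"
    using assms by (simp add: trace_mat_def index_mult_sum del: index_mult_mat(1))
  also have "\<dots> = (\<Sum>k<dim_row B. \<Sum>i<dim_row A. A $$ (i, k) * B $$ (k, i))"
    by (rule sum.swap)
  also have "\<dots> = trace_mat (B * A)"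
    using assms by (simp add: trace_mat_def index_mult_sum mult.commute del: index_mult_mat(1))
  finally show ?thesis .
qed

lemma trace_mat_smult: "dim_row A = dim_col A \<Longrightarrow> trace_mat (c \<cdot>\<^sub>m A) = c * trace_mat A"
  by (simp add: trace_mat_def sum_distrib_left)

section \<open>Positive semi-definite matrices\<close>

text \<open>Coefficients and vector are plain functions, so that an induction on \<open>d\<close>
  can restrict both to a smaller dimension and split off the last coordinate with
  \<open>f(d := t)\<close>.\<close>

definition quad_form :: "nat \<Rightarrow> (nat \<Rightarrow> nat \<Rightarrow> complex) \<Rightarrow> (nat \<Rightarrow> complex) \<Rightarrow> complex" where
  "quad_form d a f = (\<Sum>i<d. \<Sum>j<d. cnj (f i) * a i j * f j)"

lemma quad_form_cong: "(\<And>i. i < d \<Longrightarrow> f i = g i) \<Longrightarrow> quad_form d a f = quad_form d a g"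
  by (simp add: quad_form_def)

lemma quad_form_vec:
  assumes "A \<in> carrier_mat d d" "v \<in> carrier_vec d"
  shows "(A *\<^sub>v v) \<bullet>c v = quad_form d (\<lambda>i j. A $$ (i, j)) (\<lambda>i. v $ i)"
  using assms carrier_matD[OF assms(1)] by (auto simp: quad_form_def scalar_prod_def atLeast0LessThan sum_distrib_left
    conjugate_complex_def mult_ac intro!: sum.cong)

lemma psd_iff_quad_form:
  "psd d A \<longleftrightarrow> A \<in> carrier_mat d d \<and> (\<forall>f. 0 \<le> quad_form d (\<lambda>i j. A $$ (i, j)) f)"
proof -
  have "0 \<le> quad_form d (\<lambda>i j. A $$ (i, j)) f"
    if "A \<in> carrier_mat d d" "\<forall>v \<in> carrier_vec d. 0 \<le> (A *\<^sub>v v) \<bullet>c v" for f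
  proof -
    have "quad_form d (\<lambda>i j. A $$ (i, j)) f = quad_form d (\<lambda>i j. A $$ (i, j)) (\<lambda>i. vec d f $ i)"
      by (rule quad_form_cong) simp
    also have "\<dots> = (A *\<^sub>v vec d f) \<bullet>c vec d f"
      using that by (simp add: quad_form_vec)
    finally show ?thesis using that(2) by simp
  qed
  then show ?thesis by (auto simp: psd_def quad_form_vec)
qed

lemma quad_form_Suc:
  "quad_form (Suc d) a (f(d := t)) =
    quad_form d a f + cnj t * (\<Sum>j<d. a d j * f j) + t * (\<Sum>i<d. cnj (f i) * a i d) + cnj t * a d d * t"
  by (simp add: quad_form_def sum.distrib sum_distrib_left algebra_simps)

lemma quad_form_single:
  assumes "k < d"
  shows "quad_form d a (\<lambda>l. if l = k then 1 else 0) = a k k"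
proof -
  have "quad_form d a (\<lambda>l. if l = k then 1 else 0) = (\<Sum>i<d. if i = k then a i k else 0)"
    unfolding quad_form_def by (intro sum.cong refl) (use assms in \<open>auto simp: if_distrib cong: if_cong\<close>)
  then show ?thesis using assms by simp
qed

lemma quad_form_two:
  assumes "i < d" "j < d" "i \<noteq> j"
  shows "quad_form d a (\<lambda>k. if k = i then x else if k = j then y else 0) =
    cnj x * a i i * x + cnj x * a i j * y + cnj y * a j i * x + cnj y * a j j * y"
proof -
  have two: "(\<Sum>k<d. h k) = h i + h j" if "\<And>k. k \<noteq> i \<Longrightarrow> k \<noteq> j \<Longrightarrow> h k = 0" for h :: "nat \<Rightarrow> complex"
  proof -
    have "(\<Sum>k<d. h k) = sum h {i, j}"
      by (rule sum.mono_neutral_right) (use assms that in auto)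
    then show ?thesis using assms by simp
  qed
  show ?thesis
    unfolding quad_form_def
    by (subst two, simp, subst (1 2) two) (use assms in \<open>auto simp: algebra_simps\<close>)
qed

text \<open>Polarisation: the values at e_i + e_j and e_i + \<open>\<i>\<close> e_j are real, which
  makes the imaginary parts of \<open>a i j\<close> and \<open>a j i\<close> opposite and their real
  parts equal.\<close>

lemma quad_form_nonneg_hermitian:
  assumes nn: "\<And>f. 0 \<le> quad_form d a f" and "i < d" "j < d"
  shows "a j i = cnj (a i j)"
proof -
  have one: "0 \<le> a k k" if "k < d" for k
    using nn[of "\<lambda>l. if l = k then 1 else 0"] that by (simp add: quad_form_single)
  show ?thesis
  proof (cases "i = j")
    case True
    then show ?thesis using one[of i] assms by (simp add: less_eq_complex_def complex_eq_iff)
  next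
    case False
    have "0 \<le> quad_form d a (\<lambda>k. if k = i then 1 else if k = j then 1 else 0)"
      "0 \<le> quad_form d a (\<lambda>k. if k = i then 1 else if k = j then \<i> else 0)"
      by (rule nn)+
    then show ?thesis using one[of i] one[of j] assms False
      by (simp add: quad_form_two less_eq_complex_def complex_eq_iff)
  qed
qed

text \<open>Schur complement of the last diagonal entry.\<close>

lemma quad_form_nonneg_decomp:
  assumes "\<And>f. 0 \<le> quad_form d a f"
  shows "\<exists>w. \<forall>i<d. \<forall>j<d. a i j = (\<Sum>s<d. w s i * cnj (w s j))"
  using assms
proof (induction d arbitrary: a)
  case 0
  then show ?case by simp
next
  case (Suc d)
  define u where "u f = (\<Sum>j<d. a d j * f j)" for f
  have herm: "a j i = cnj (a i j)" if "i < Suc d" "j < Suc d" for i j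
    using quad_form_nonneg_hermitian[OF Suc.prems that] .
  have ucnj: "(\<Sum>i<d. cnj (f i) * a i d) = cnj (u f)" for f
    using herm[of d] by (auto simp: u_def mult.commute intro!: sum.cong)
  have nn: "0 \<le> quad_form d a f + cnj t * u f + t * cnj (u f) + cnj t * a d d * t" for f t
    using Suc.prems[of "f(d := t)"] unfolding quad_form_Suc ucnj u_def[symmetric] .
  have add0: "0 \<le> a d d"
    using nn[of "\<lambda>_. 0" 1] by (simp add: quad_form_def u_def)
  show ?case
  proof (cases "a d d = 0")
    case True
    have u0: "u f = 0" for f
    proof (rule ccontr)
      assume "u f \<noteq> 0"
      define B where "B = Re (quad_form d a f)"
      define N where "N = (cmod (u f))\<^sup>2"
      have N: "N > 0" using \<open>u f \<noteq> 0\<close> by (simp add: N_def)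
      have N2: "N = Re (u f) * Re (u f) + Im (u f) * Im (u f)"
        unfolding N_def cmod_power2 by (simp add: power2_eq_square)
      \<comment> \<open>The vector (f, t) with t = -s u(f) makes the form linear in s, because the
        corner entry is 0; a large s makes it negative. The value of s chosen below gives
        -1.\<close>
      have "0 \<le> B - 2 * s * N" for s :: real
        using nn[of f "- complex_of_real s * u f"] True
        by (simp add: less_eq_complex_def B_def N2 algebra_simps)
      from this[of "(B + 1) / (2 * N)"] show False using N by simp
    qed
    have row0: "a d j = 0" if "j < d" for j
      using u0[of "\<lambda>k. if k = j then 1 else 0"] that by (simp add: u_def if_distrib cong: if_cong)
    have col0: "a j d = 0" if "j < d" for j
      using row0[OF that] herm[of d j] that by simp
    have "0 \<le> quad_form d a f" for f
      using nn[of f 0] by simp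
    from Suc.IH[OF this] obtain w where w: "\<forall>i<d. \<forall>j<d. a i j = (\<Sum>s<d. w s i * cnj (w s j))"
      by blast
    \<comment> \<open>The last row and column vanish, so the decomposition of the smaller matrix is
      padded by zeros, both in the new coordinate and in the new summand.\<close>
    show ?thesis
      by (rule exI[of _ "\<lambda>s i. if s < d \<and> i < d then w s i else 0"])
        (use w row0 col0 True in \<open>auto simp: less_Suc_eq\<close>)
  next
    case False
    define r where "r = Re (a d d)"
    have r: "a d d = complex_of_real r" "r > 0"
      using add0 False by (auto simp: r_def less_eq_complex_def complex_eq_iff)
    \<comment> \<open>The rank-one matrix with entries v_i conj(v_j) agrees with \<open>a\<close> in
      the last row and column, so subtracting it leaves a problem of dimension
      \<open>d\<close>.\<close>
    define v where "v i = a i d / complex_of_real (sqrt r)" for i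
    have vv: "v i * cnj (v j) = a i d * a d j / complex_of_real r" if "i < Suc d" "j < Suc d" for i j
    proof -
      have "v i * cnj (v j) = a i d * cnj (a j d) / (complex_of_real (sqrt r) * complex_of_real (sqrt r))"
        by (simp add: v_def)
      also have "complex_of_real (sqrt r) * complex_of_real (sqrt r) = complex_of_real r"
        using r by (simp flip: of_real_mult)
      also have "cnj (a j d) = a d j"
        using herm[of j d] that by simp
      finally show ?thesis .
    qed
    define b where "b i j = a i j - v i * cnj (v j)" for i j
    have "0 \<le> quad_form d b f" for f
    proof -
      \<comment> \<open>Completing the square: this t minimises the form over the last coordinate,
        and the minimum is the form of the Schur complement \<open>b\<close>.\<close>
      define t where "t = - u f / complex_of_real r"
      have "quad_form d b f = quad_form d a f - (\<Sum>i<d. \<Sum>j<d. (cnj (f i) * a i d) * (a d j * f j) / complex_of_real r)"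
        unfolding quad_form_def b_def sum_subtractf[symmetric]
        by (intro sum.cong refl) (simp add: vv algebra_simps)
      also have "(\<Sum>i<d. \<Sum>j<d. (cnj (f i) * a i d) * (a d j * f j) / complex_of_real r) = cnj (u f) * u f / complex_of_real r"
        unfolding ucnj[symmetric] by (simp add: sum_product u_def sum_divide_distrib)
      also have "quad_form d a f - cnj (u f) * u f / complex_of_real r =
          quad_form d a f + cnj t * u f + t * cnj (u f) + cnj t * a d d * t"
        using r by (simp add: t_def field_simps)
      finally show ?thesis using nn[of f t] by simp
    qed
    from Suc.IH[OF this] obtain w where w: "\<forall>i<d. \<forall>j<d. b i j = (\<Sum>s<d. w s i * cnj (w s j))"
      by blast
    have bd: "b i d = 0" "b d i = 0" if "i < Suc d" for i
      using vv[of i d] vv[of d i] that r by (auto simp: b_def)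
    show ?thesis
    proof (intro exI[of _ "\<lambda>s i. if s = d then v i else if i < d then w s i else 0"] allI impI)
      fix i j assume ij: "i < Suc d" "j < Suc d"
      have "b i j = (\<Sum>s<d. (if i < d then w s i else 0) * cnj (if j < d then w s j else 0))"
        using w bd ij by (auto simp: less_Suc_eq)
      then show "a i j = (\<Sum>s<Suc d. (if s = d then v i else if i < d then w s i else 0) *
          cnj (if s = d then v j else if j < d then w s j else 0))"
        by (simp add: b_def diff_eq_eq)
    qed
  qed
qed

section \<open>Completely positive maps and Kraus operators\<close>

lemma sum_blocks:
  fixes h :: "nat \<Rightarrow> 'a :: comm_monoid_add"
  shows "(\<Sum>t<n * p. h t) = (\<Sum>a<n. \<Sum>k<p. h (a * p + k))"
proof (induction n)
  case (Suc n)
  have "(\<Sum>t<m + k. h t) = (\<Sum>t<m. h t) + (\<Sum>i<k. h (m + i))" for m k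
    by (induction k) (auto simp: add.assoc)
  from this[of "n * p" p] Suc show ?case by (simp add: add.commute)
qed simp

text \<open>This is the action of a row of 1 tensor K: the condition selects the block
  \<open>a\<close>, and \<open>g\<close> is the corresponding row of K.\<close>

lemma sum_single_block:
  fixes h g :: "nat \<Rightarrow> 'a :: comm_semiring_1"
  assumes "a < n"
  shows "(\<Sum>t<n * p. (if t div p = a then g (t mod p) else 0) * h t) = (\<Sum>k<p. g k * h (a * p + k))"
proof -
  have "(\<Sum>t<n * p. (if t div p = a then g (t mod p) else 0) * h t) =
      (\<Sum>b<n. \<Sum>k<p. if b = a then g k * h (b * p + k) else 0)"
    unfolding sum_blocks by (intro sum.cong refl) auto
  also have "\<dots> = (\<Sum>b<n. if b = a then \<Sum>k<p. g k * h (b * p + k) else 0)"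
    by (intro sum.cong refl) auto
  finally show ?thesis using assms by simp
qed

text \<open>The nesting of the two sums is chosen so that \<open>sum_single_block\<close> can be
  applied first to one and then to the other.\<close>

lemma index_congruence:
  assumes "A \<in> carrier_mat q p" "X \<in> carrier_mat p p" "k < q" "l < q"
  shows "(A * X * mat_adjoint A) $$ (k, l) =
    (\<Sum>a<p. A $$ (k, a) * (\<Sum>b<p. cnj (A $$ (l, b)) * X $$ (a, b)))"
proof -
  note d = carrier_matD[OF assms(1)] carrier_matD[OF assms(2)]
  have "A * X * mat_adjoint A = A * (X * mat_adjoint A)"
    using d by (simp add: mat_mult_assoc)
  then show ?thesis
    using d assms(3,4) by (simp add: index_mult_sum mult.commute del: index_mult_mat(1))
qed

definition kraus_map :: "nat \<Rightarrow> ('s \<Rightarrow> complex mat) \<Rightarrow> 's set \<Rightarrow> complex mat \<Rightarrow> complex mat" where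
  "kraus_map m K S X = mat_sum m m (\<lambda>s. K s * X * mat_adjoint (K s)) S"

lemma index_kraus_map:
  assumes "\<And>s. s \<in> S \<Longrightarrow> K s \<in> carrier_mat q p" "X \<in> carrier_mat p p" "k < q" "l < q"
  shows "kraus_map q K S X $$ (k, l) =
    (\<Sum>s\<in>S. \<Sum>a<p. K s $$ (k, a) * (\<Sum>b<p. cnj (K s $$ (l, b)) * X $$ (a, b)))"
  using assms by (auto simp: kraus_map_def mat_sum_def intro!: sum.cong index_congruence)

lemma kraus_map_carrier [simp]:
  "kraus_map q K S X \<in> carrier_mat q q"
  "dim_row (kraus_map q K S X) = q" "dim_col (kraus_map q K S X) = q"
  by (simp_all add: kraus_map_def)

lemma linear_superopD:
  assumes "linear_superop p q E"
  shows "X \<in> carrier_mat p p \<Longrightarrow> E X \<in> carrier_mat q q"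
    "X \<in> carrier_mat p p \<Longrightarrow> Y \<in> carrier_mat p p \<Longrightarrow> E (X + Y) = E X + E Y"
    "X \<in> carrier_mat p p \<Longrightarrow> E (c \<cdot>\<^sub>m X) = c \<cdot>\<^sub>m E X"
  using assms by (auto simp: linear_superop_def LinearCombinations.module_hom_def module_mat_simps)

lemma linear_superopI:
  assumes "\<And>X. X \<in> carrier_mat p p \<Longrightarrow> E X \<in> carrier_mat q q"
    "\<And>X Y. X \<in> carrier_mat p p \<Longrightarrow> Y \<in> carrier_mat p p \<Longrightarrow> E (X + Y) = E X + E Y"
    "\<And>X c. X \<in> carrier_mat p p \<Longrightarrow> E (c \<cdot>\<^sub>m X) = c \<cdot>\<^sub>m E X"
  shows "linear_superop p q E"
  using assms by (auto simp: linear_superop_def LinearCombinations.module_hom_def module_mat_simps)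

lemma linear_superop_mat_sum:
  assumes E: "linear_superop p q E" and "finite S" and F: "\<And>s. s \<in> S \<Longrightarrow> F s \<in> carrier_mat p p"
  shows "E (mat_sum p p F S) = mat_sum q q (\<lambda>s. E (F s)) S"
  using assms(2,3)
proof (induction S)
  case empty
  \<comment> \<open>Both empty sums are written as 0 times a matrix, so that homogeneity gives that
    E maps zero to zero.\<close>
  have "mat_sum p p F {} = 0 \<cdot>\<^sub>m 0\<^sub>m p p" "mat_sum q q (\<lambda>s. E (F s)) {} = 0 \<cdot>\<^sub>m E (0\<^sub>m p p)"
    using linear_superopD(1)[OF E, of "0\<^sub>m p p"] by (auto simp: mat_sum_def intro!: eq_matI)
  then show ?case using linear_superopD(3)[OF E, of "0\<^sub>m p p" 0] by simp
next
  case (insert x S)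
  have "mat_sum p p F (insert x S) = F x + mat_sum p p F S"
    using insert carrier_matD[OF insert.prems, of x] by (intro eq_matI) (auto simp: mat_sum_def)
  moreover have "mat_sum q q (\<lambda>s. E (F s)) (insert x S) = E (F x) + mat_sum q q (\<lambda>s. E (F s)) S"
    using insert carrier_matD[OF linear_superopD(1)[OF E insert.prems], of x]
    by (intro eq_matI) (auto simp: mat_sum_def)
  ultimately show ?case
    using insert by (simp add: linear_superopD(2)[OF E])
qed

section \<open>Positivity of Kraus maps and their ampliations\<close>

lemma mult_mat_vec_cscalar_prod:
  fixes A :: "complex mat"
  assumes "A \<in> carrier_mat m n" "u \<in> carrier_vec n" "v \<in> carrier_vec m"
  shows "(A *\<^sub>v u) \<bullet>c v = u \<bullet>c (mat_adjoint A *\<^sub>v v)"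
proof -
  note d = carrier_matD[OF assms(1)] carrier_vecD[OF assms(2)] carrier_vecD[OF assms(3)]
  have "(A *\<^sub>v u) \<bullet>c v = (\<Sum>i<m. \<Sum>a<n. A $$ (i, a) * u $ a * cnj (v $ i))"
    using d by (simp add: scalar_prod_def atLeast0LessThan sum_distrib_right conjugate_complex_def)
  also have "\<dots> = (\<Sum>a<n. \<Sum>i<m. A $$ (i, a) * u $ a * cnj (v $ i))"
    by (rule sum.swap)
  also have "\<dots> = u \<bullet>c (mat_adjoint A *\<^sub>v v)"
    using d by (simp add: scalar_prod_def atLeast0LessThan sum_distrib_left conjugate_complex_def mult_ac)
  finally show ?thesis .
qed

text \<open>M can be moved onto the vector: the form of M X M^* at v is the form of X at M^*
  v.\<close>

lemma psd_congruence:
  assumes X: "psd n X" and M: "M \<in> carrier_mat m n"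
  shows "psd m (M * X * mat_adjoint M)"
  unfolding psd_def
proof (intro conjI ballI)
  have Xc: "X \<in> carrier_mat n n" using X by (simp add: psd_def)
  have Mc: "mat_adjoint M \<in> carrier_mat n m" using M by simp
  show "M * X * mat_adjoint M \<in> carrier_mat m m" using M Xc Mc by (meson mult_carrier_mat)
  fix v :: "complex vec" assume v: "v \<in> carrier_vec m"
  let ?w = "mat_adjoint M *\<^sub>v v"
  have w: "?w \<in> carrier_vec n" using Mc v by (rule mult_mat_vec_carrier)
  have "M * X * mat_adjoint M *\<^sub>v v = M *\<^sub>v (X *\<^sub>v ?w)"
    using assoc_mult_mat_vec[OF mult_carrier_mat[OF M Xc] Mc v] assoc_mult_mat_vec[OF M Xc w] by simp
  then have "(M * X * mat_adjoint M *\<^sub>v v) \<bullet>c v = (X *\<^sub>v ?w) \<bullet>c ?w"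
    using mult_mat_vec_cscalar_prod[OF M mult_mat_vec_carrier[OF Xc w] v] by simp
  then show "0 \<le> (M * X * mat_adjoint M *\<^sub>v v) \<bullet>c v"
    using X w by (simp add: psd_def)
qed

lemma psd_one: "psd d (1\<^sub>m d)"
  unfolding psd_def by (auto intro: conjugate_square_ge_0_vec)

lemma psd_mat_sum:
  assumes "\<And>s. s \<in> S \<Longrightarrow> psd m (F s)"
  shows "psd m (mat_sum m m F S)"
proof -
  have "quad_form m (\<lambda>i j. mat_sum m m F S $$ (i, j)) f =
      (\<Sum>s\<in>S. quad_form m (\<lambda>i j. F s $$ (i, j)) f)" for f
  proof -
    have "quad_form m (\<lambda>i j. mat_sum m m F S $$ (i, j)) f =
        (\<Sum>i<m. \<Sum>j<m. \<Sum>s\<in>S. cnj (f i) * F s $$ (i, j) * f j)"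
      by (simp add: quad_form_def mat_sum_def sum_distrib_left sum_distrib_right)
    also have "\<dots> = (\<Sum>i<m. \<Sum>s\<in>S. \<Sum>j<m. cnj (f i) * F s $$ (i, j) * f j)"
      by (intro sum.cong refl sum.swap)
    also have "\<dots> = (\<Sum>s\<in>S. \<Sum>i<m. \<Sum>j<m. cnj (f i) * F s $$ (i, j) * f j)"
      by (rule sum.swap)
    finally show ?thesis by (simp add: quad_form_def)
  qed
  then show ?thesis
    using assms by (auto simp: psd_iff_quad_form intro!: sum_nonneg)
qed

text \<open>Tensoring with the identity keeps the Kraus form, with 1 tensor K_s in place of K_s.
  Complete positivity thereby reduces to positivity of a sum of congruences.\<close>

lemma ampliation_kraus_map:
  assumes K: "\<And>s. s \<in> S \<Longrightarrow> K s \<in> carrier_mat q p" and X: "X \<in> carrier_mat (n * p) (n * p)"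
  shows "ampliation n p q (kraus_map q K S) X = kraus_map (n * q) (\<lambda>s. kronecker (1\<^sub>m n) (K s)) S X"
proof (rule eq_matI)
  fix i j assume "i < dim_row (kraus_map (n * q) (\<lambda>s. kronecker (1\<^sub>m n) (K s)) S X)"
    "j < dim_col (kraus_map (n * q) (\<lambda>s. kronecker (1\<^sub>m n) (K s)) S X)"
  then have ij: "i < n * q" "j < n * q" by auto
  then have q: "q > 0" by (cases q) auto
  have ab: "i div q < n" "j div q < n" using ij by (auto simp: less_mult_imp_div_less)
  have Kc: "kronecker (1\<^sub>m n) (K s) \<in> carrier_mat (n * q) (n * p)" if "s \<in> S" for s
    using carrier_matD[OF K[OF that]] by (simp add: kronecker_def)
  have Kij: "kronecker (1\<^sub>m n) (K s) $$ (l, t) = (if t div p = l div q then K s $$ (l mod q, t mod p) else 0)"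
    if "s \<in> S" "l < n * q" "t < n * p" for s l t
    using carrier_matD[OF K[OF that(1)]] that(2,3) by (auto simp: kronecker_def less_mult_imp_div_less)
  have "kraus_map (n * q) (\<lambda>s. kronecker (1\<^sub>m n) (K s)) S X $$ (i, j) =
      (\<Sum>s\<in>S. \<Sum>t<n * p. (if t div p = i div q then K s $$ (i mod q, t mod p) else 0) *
        (\<Sum>u<n * p. (if u div p = j div q then cnj (K s $$ (j mod q, u mod p)) else 0) * X $$ (t, u)))"
    using Kc X ij by (subst index_kraus_map[where p = "n * p"])
      (auto simp only: Kij if_distrib[of cnj] complex_cnj_zero lessThan_iff intro!: sum.cong arg_cong2[where f = "(*)"])
  also have "\<dots> = (\<Sum>s\<in>S. \<Sum>k<p. K s $$ (i mod q, k) *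
        (\<Sum>l<p. cnj (K s $$ (j mod q, l)) * X $$ (i div q * p + k, j div q * p + l)))"
    using sum_single_block[OF ab(1), where p = p and g = "\<lambda>m. K s $$ (i mod q, m)" for s]
      sum_single_block[OF ab(2), where p = p and g = "\<lambda>m. cnj (K s $$ (j mod q, m))" for s]
    by simp
  also have "\<dots> = ampliation n p q (kraus_map q K S) X $$ (i, j)"
    using ij q K by (simp add: ampliation_def index_kraus_map[where p = p])
  finally show "ampliation n p q (kraus_map q K S) X $$ (i, j) =
    kraus_map (n * q) (\<lambda>s. kronecker (1\<^sub>m n) (K s)) S X $$ (i, j)" ..
qed (auto simp: ampliation_def)

lemma completely_positive_kraus_map:
  assumes K: "\<And>s. s \<in> S \<Longrightarrow> K s \<in> carrier_mat q p"
  shows "completely_positive p q (kraus_map q K S)"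
  unfolding completely_positive_def
proof (intro conjI allI impI linear_superopI)
  show "kraus_map q K S (X + Y) = kraus_map q K S X + kraus_map q K S Y"
    if "X \<in> carrier_mat p p" "Y \<in> carrier_mat p p" for X Y
    using that K carrier_matD[OF that(1)] carrier_matD[OF that(2)]
    by (intro eq_matI) (simp_all add: index_kraus_map[where p = p] sum.distrib distrib_left)
  show "kraus_map q K S (c \<cdot>\<^sub>m X) = c \<cdot>\<^sub>m kraus_map q K S X"
    if "X \<in> carrier_mat p p" for X c
    using that K carrier_matD[OF that]
    by (intro eq_matI) (simp_all add: index_kraus_map[where p = p] sum_distrib_left mult_ac)
  fix n X assume X: "psd (n * p) X"
  have Kc: "kronecker (1\<^sub>m n) (K s) \<in> carrier_mat (n * q) (n * p)" if "s \<in> S" for s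
    using carrier_matD[OF K[OF that]] by (simp add: kronecker_def)
  have "psd (n * q) (kraus_map (n * q) (\<lambda>s. kronecker (1\<^sub>m n) (K s)) S X)"
    unfolding kraus_map_def by (intro psd_mat_sum psd_congruence[OF X] Kc)
  then show "psd (n * q) (ampliation n p q (kraus_map q K S) X)"
    using ampliation_kraus_map[where S = S and K = K, OF K, of X n] X by (simp add: psd_def)
qed simp

section \<open>Kraus operators from the Choi matrix\<close>

definition outer :: "nat \<Rightarrow> (nat \<Rightarrow> complex) \<Rightarrow> complex mat" where
  "outer d f = mat d d (\<lambda>(i, j). f i * cnj (f j))"

lemma psd_outer: "psd d (outer d f)"
proof -
  have "quad_form d (\<lambda>i j. outer d f $$ (i, j)) g =
      (\<Sum>i<d. cnj (g i) * f i) * cnj (\<Sum>i<d. cnj (g i) * f i)" for g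
    by (simp add: quad_form_def outer_def sum_product mult_ac)
  moreover have "0 \<le> z * cnj z" for z
    by (simp add: less_eq_complex_def)
  ultimately have "0 \<le> quad_form d (\<lambda>i j. outer d f $$ (i, j)) g" for g
    by (simp only:)
  then show ?thesis
    by (simp add: psd_iff_quad_form) (simp add: outer_def)
qed

text \<open>The Kraus operators are the vectors of a rank-one decomposition of the Choi matrix.\<close>

lemma completely_positive_imp_kraus:
  assumes E: "completely_positive p q E"
  obtains r :: nat and K where "\<And>s. s < r \<Longrightarrow> K s \<in> carrier_mat q p"
    "\<And>X. X \<in> carrier_mat p p \<Longrightarrow> E X = kraus_map q K {..<r} X"
proof -
  \<comment> \<open>The unnormalised maximally entangled state, built on the sum of all e_a tensor
    e_a. Its block (a, b) is the matrix unit \<open>U (a, b)\<close>, so its image under the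
    ampliation is the Choi matrix with blocks \<open>E (U (a, b))\<close>.\<close>
  define \<Omega> where "\<Omega> = outer (p * p) (\<lambda>i. if i div p = i mod p then 1 else 0)"
  define U where "U = (\<lambda>(a, b). mat p p (\<lambda>(k, l). if k = a \<and> l = b then 1 :: complex else 0))"
  have lin: "linear_superop p q E" using E by (simp add: completely_positive_def)
  have EU: "E (U ab) \<in> carrier_mat q q" for ab
    by (rule linear_superopD(1)[OF lin]) (simp add: U_def split: prod.split)
  have psd: "psd (p * q) (ampliation p p q E \<Omega>)"
    using E psd_outer by (simp add: completely_positive_def \<Omega>_def)
  obtain w where w: "\<And>i j. i < p * q \<Longrightarrow> j < p * q \<Longrightarrow>
      ampliation p p q E \<Omega> $$ (i, j) = (\<Sum>s<p * q. w s i * cnj (w s j))"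
    using quad_form_nonneg_decomp[of "p * q" "\<lambda>i j. ampliation p p q E \<Omega> $$ (i, j)"] psd
    unfolding psd_iff_quad_form by blast
  \<comment> \<open>Each vector of C^p tensor C^q in the decomposition is reshaped into an operator
    from C^p to C^q: its block \<open>a\<close> becomes column \<open>a\<close>.\<close>
  define K where "K s = mat q p (\<lambda>(k, a). w s (a * q + k))" for s
  have idx: "a * d + k < p * d" if "a < p" "k < d" for a k d
  proof -
    have "a * d + k < Suc a * d" using that by simp
    also have "\<dots> \<le> p * d" using that by (intro mult_le_mono1) simp
    finally show ?thesis .
  qed
  have choi: "E (U (a, b)) $$ (k, l) = (\<Sum>s<p * q. K s $$ (k, a) * cnj (K s $$ (l, b)))"
    if "a < p" "b < p" "k < q" "l < q" for a b k l
  proof -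
    have "mat p p (\<lambda>(k, l). \<Omega> $$ (a * p + k, b * p + l)) = U (a, b)"
      using that idx[of a _ p] idx[of b _ p] by (intro eq_matI) (auto simp: \<Omega>_def U_def outer_def)
    then have "ampliation p p q E \<Omega> $$ (a * q + k, b * q + l) = E (U (a, b)) $$ (k, l)"
      using that idx[of a k q] idx[of b l q] by (simp add: ampliation_def)
    then show ?thesis
      using that w[OF idx[of a k q] idx[of b l q]] by (simp add: K_def)
  qed
  have "E X = kraus_map q K {..<p * q} X" if X: "X \<in> carrier_mat p p" for X
  proof -
    \<comment> \<open>By linearity it suffices to know E on matrix units, and those values are the
      Choi blocks computed in \<open>choi\<close>.\<close>
    have "X = mat_sum p p (\<lambda>ab. X $$ ab \<cdot>\<^sub>m U ab) ({..<p} \<times> {..<p})"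
    proof (rule eq_matI)
      fix i j assume "i < dim_row (mat_sum p p (\<lambda>ab. X $$ ab \<cdot>\<^sub>m U ab) ({..<p} \<times> {..<p}))"
        "j < dim_col (mat_sum p p (\<lambda>ab. X $$ ab \<cdot>\<^sub>m U ab) ({..<p} \<times> {..<p}))"
      then have ij: "i < p" "j < p" by auto
      have "mat_sum p p (\<lambda>ab. X $$ ab \<cdot>\<^sub>m U ab) ({..<p} \<times> {..<p}) $$ (i, j) =
          (\<Sum>ab\<in>{..<p} \<times> {..<p}. (X $$ ab \<cdot>\<^sub>m U ab) $$ (i, j))"
        using ij by (simp add: mat_sum_def)
      also have "\<dots> = (\<Sum>ab\<in>{..<p} \<times> {..<p}. if ab = (i, j) then X $$ ab else 0)"
        by (intro sum.cong refl) (use ij in \<open>auto simp: U_def split: if_splits\<close>)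
      finally show "X $$ (i, j) = mat_sum p p (\<lambda>ab. X $$ ab \<cdot>\<^sub>m U ab) ({..<p} \<times> {..<p}) $$ (i, j)"
        using ij by simp
    qed (use X in auto)
    then have "E X = E (mat_sum p p (\<lambda>ab. X $$ ab \<cdot>\<^sub>m U ab) ({..<p} \<times> {..<p}))"
      by simp
    also have "\<dots> = mat_sum q q (\<lambda>ab. E (X $$ ab \<cdot>\<^sub>m U ab)) ({..<p} \<times> {..<p})"
      by (rule linear_superop_mat_sum[OF lin]) (auto simp: U_def)
    also have "\<dots> = mat_sum q q (\<lambda>ab. X $$ ab \<cdot>\<^sub>m E (U ab)) ({..<p} \<times> {..<p})"
      by (intro mat_sum_cong linear_superopD(3)[OF lin]) (auto simp: U_def)
    also have "\<dots> = kraus_map q K {..<p * q} X"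
    proof (rule eq_matI)
      fix k l assume "k < dim_row (kraus_map q K {..<p * q} X)" "l < dim_col (kraus_map q K {..<p * q} X)"
      then have kl: "k < q" "l < q" by auto
      have "mat_sum q q (\<lambda>ab. X $$ ab \<cdot>\<^sub>m E (U ab)) ({..<p} \<times> {..<p}) $$ (k, l) =
          (\<Sum>(a, b)\<in>{..<p} \<times> {..<p}. X $$ (a, b) * E (U (a, b)) $$ (k, l))"
        using kl carrier_matD[OF EU] by (simp add: mat_sum_def split_def)
      also have "\<dots> = (\<Sum>(a, b)\<in>{..<p} \<times> {..<p}. \<Sum>s<p * q. K s $$ (k, a) * (cnj (K s $$ (l, b)) * X $$ (a, b)))"
        using kl by (intro sum.cong refl) (auto simp: choi sum_distrib_left mult_ac)
      also have "\<dots> = (\<Sum>s<p * q. \<Sum>(a, b)\<in>{..<p} \<times> {..<p}. K s $$ (k, a) * (cnj (K s $$ (l, b)) * X $$ (a, b)))"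
        unfolding split_def by (rule sum.swap)
      also have "\<dots> = kraus_map q K {..<p * q} X $$ (k, l)"
        using kl X by (subst index_kraus_map[where p = p])
          (auto simp: K_def sum.cartesian_product[symmetric] sum_distrib_left)
      finally show "mat_sum q q (\<lambda>ab. X $$ ab \<cdot>\<^sub>m E (U ab)) ({..<p} \<times> {..<p}) $$ (k, l) =
        kraus_map q K {..<p * q} X $$ (k, l)" .
    qed auto
    finally show ?thesis .
  qed
  moreover have "K s \<in> carrier_mat q p" for s by (simp add: K_def)
  ultimately show thesis using that by blast
qed

section \<open>Kraus representations of the identity\<close>

lemma density_matrix_carrier: "density_matrix d \<rho> \<Longrightarrow> \<rho> \<in> carrier_mat d d"
  by (simp add: density_matrix_def psd_def)

lemma psd_smult:
  assumes "psd d A" "c \<ge> 0"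
  shows "psd d (complex_of_real c \<cdot>\<^sub>m A)"
proof -
  have A: "A \<in> carrier_mat d d" "0 \<le> quad_form d (\<lambda>i j. A $$ (i, j)) f" for f
    using assms by (auto simp: psd_iff_quad_form)
  have "quad_form d (\<lambda>i j. (complex_of_real c \<cdot>\<^sub>m A) $$ (i, j)) f =
      complex_of_real c * quad_form d (\<lambda>i j. A $$ (i, j)) f" for f
    using carrier_matD[OF A(1)] by (simp add: quad_form_def sum_distrib_left mult_ac)
  then show ?thesis
    using A assms(2) by (simp add: psd_iff_quad_form less_eq_complex_def)
qed

lemma outer_carrier [simp]:
  "outer d f \<in> carrier_mat d d" "dim_row (outer d f) = d" "dim_col (outer d f) = d"
  by (simp_all add: outer_def)

text \<open>Inversion and the trace condition are stated for density matrices only; normalising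
  makes every nonzero vector available as a test input.\<close>

lemma density_outer:
  fixes f :: "nat \<Rightarrow> complex"
  assumes "k < d" "f k \<noteq> 0"
  shows "density_matrix d (complex_of_real (1 / (\<Sum>i<d. (cmod (f i))\<^sup>2)) \<cdot>\<^sub>m outer d f)"
    and "(\<Sum>i<d. (cmod (f i))\<^sup>2) > 0"
proof -
  show pos: "(\<Sum>i<d. (cmod (f i))\<^sup>2) > 0"
    using assms by (intro sum_pos2[of _ k]) auto
  have "trace_mat (outer d f) = complex_of_real (\<Sum>i<d. (cmod (f i))\<^sup>2)"
    by (simp add: trace_mat_def outer_def flip: complex_norm_square)
  then show "density_matrix d (complex_of_real (1 / (\<Sum>i<d. (cmod (f i))\<^sup>2)) \<cdot>\<^sub>m outer d f)"
    using pos unfolding density_matrix_def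
    by (intro conjI psd_smult psd_outer) (auto simp: trace_mat_smult simp flip: of_real_sum of_real_power)
qed

lemma trace_mult_outer:
  assumes "A \<in> carrier_mat d d"
  shows "trace_mat (A * outer d f) = quad_form d (\<lambda>i j. A $$ (i, j)) f"
  using carrier_matD[OF assms]
  by (simp add: trace_mat_def index_mult_sum quad_form_def outer_def mult_ac del: index_mult_mat(1))

text \<open>Pure states already separate operators: they determine the quadratic form at nonzero
  vectors, and polarisation with e_i, e_i + e_j and e_i + \<open>\<i>\<close> e_j recovers the
  entries.\<close>

lemma eq_mat_if_trace_eq:
  assumes A: "A \<in> carrier_mat d d" and B: "B \<in> carrier_mat d d"
    and tr: "\<And>\<rho>. density_matrix d \<rho> \<Longrightarrow> trace_mat (A * \<rho>) = trace_mat (B * \<rho>)"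
  shows "A = B"
proof -
  have q: "quad_form d (\<lambda>i j. A $$ (i, j)) f = quad_form d (\<lambda>i j. B $$ (i, j)) f"
    if "k < d" "f k \<noteq> 0" for f k
    using tr[OF density_outer(1)[of k d f, OF that]] density_outer(2)[of k d f, OF that]
      carrier_matD[OF A] carrier_matD[OF B]
    by (simp add: mat_mult_smult trace_mat_smult trace_mult_outer[OF A] trace_mult_outer[OF B]
        del: of_real_divide of_real_sum)
  have diag: "A $$ (i, i) = B $$ (i, i)" if "i < d" for i
    using q[of i "\<lambda>l. if l = i then 1 else 0"] that by (simp add: quad_form_single)
  have "A $$ (i, j) = B $$ (i, j)" if "i < d" "j < d" "i \<noteq> j" for i j
  proof -
    have "A $$ (i, j) + A $$ (j, i) = B $$ (i, j) + B $$ (j, i)"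
      using q[of i "\<lambda>k. if k = i then 1 else if k = j then 1 else 0"] that diag
      by (simp add: quad_form_two)
    moreover have "\<i> * (A $$ (i, j) - A $$ (j, i)) = \<i> * (B $$ (i, j) - B $$ (j, i))"
      using q[of i "\<lambda>k. if k = i then 1 else if k = j then \<i> else 0"] that diag
      by (simp add: quad_form_two algebra_simps)
    ultimately have "A $$ (i, j) + A $$ (j, i) = B $$ (i, j) + B $$ (j, i)"
      "A $$ (i, j) - A $$ (j, i) = B $$ (i, j) - B $$ (j, i)"
      by simp_all
    then show ?thesis by (simp add: complex_eq_iff)
  qed
  with diag A B show ?thesis
    by (intro eq_matI) (metis carrier_matD)+
qed

lemma sum_mult_cnj_eq_0:
  assumes "finite S" "(\<Sum>s\<in>S. z s * cnj (z s)) = 0" "s \<in> S"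
  shows "z s = 0"
proof -
  have "complex_of_real (\<Sum>s\<in>S. (cmod (z s))\<^sup>2) = 0"
    using assms(2) by (simp flip: complex_norm_square)
  then have "(\<Sum>s\<in>S. (cmod (z s))\<^sup>2) = 0"
    by (simp only: of_real_eq_0_iff)
  then show ?thesis
    using assms(1,3) by (subst (asm) sum_nonneg_eq_0_iff) auto
qed

text \<open>Feeding in the pure states \<open>e\<^sub>b\<close> and \<open>e\<^sub>a + e\<^sub>b\<close> shows that the off-diagonal entries of
  each Kraus operator vanish and that its diagonal entries agree.\<close>

lemma kraus_identity_scalar:
  assumes p: "p > 0" and S: "finite S" and M: "\<And>s. s \<in> S \<Longrightarrow> M s \<in> carrier_mat p p"
    and id: "\<And>\<rho>. density_matrix p \<rho> \<Longrightarrow> kraus_map p M S \<rho> = \<rho>"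
  obtains l where "\<And>s. s \<in> S \<Longrightarrow> M s = l s \<cdot>\<^sub>m 1\<^sub>m p" "(\<Sum>s\<in>S. l s * cnj (l s)) = 1"
proof -
  have lin: "linear_superop p p (kraus_map p M S)"
    using completely_positive_kraus_map[where K = M and S = S, OF M] by (simp add: completely_positive_def)
  \<comment> \<open>By homogeneity the normalising factor cancels, so the hypothesis becomes an
    entrywise identity for arbitrary nonzero vectors f: the vectors M_s f form a rank-one
    decomposition of the projector onto f, up to scale.\<close>
  have pure: "(\<Sum>s\<in>S. (\<Sum>a<p. M s $$ (k, a) * f a) * cnj (\<Sum>a<p. M s $$ (l, a) * f a)) = f k * cnj (f l)"
    if "m < p" "f m \<noteq> 0" "k < p" "l < p" for f m k l
  proof -
    define c where "c = complex_of_real (1 / (\<Sum>i<p. (cmod (f i))\<^sup>2))"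
    have "c \<noteq> 0"
      using density_outer(2)[of m p f, OF that(1,2)] by (simp add: c_def del: of_real_divide of_real_sum)
    have "c \<cdot>\<^sub>m kraus_map p M S (outer p f) = c \<cdot>\<^sub>m outer p f"
      using id[OF density_outer(1)[of m p f, OF that(1,2)]] linear_superopD(3)[OF lin, of "outer p f"]
      unfolding c_def by simp
    then have "(c \<cdot>\<^sub>m kraus_map p M S (outer p f)) $$ (k, l) = (c \<cdot>\<^sub>m outer p f) $$ (k, l)"
      by simp
    then have "kraus_map p M S (outer p f) $$ (k, l) = outer p f $$ (k, l)"
      using that \<open>c \<noteq> 0\<close> by simp
    moreover have "kraus_map p M S (outer p f) $$ (k, l) =
        (\<Sum>s\<in>S. (\<Sum>a<p. M s $$ (k, a) * f a) * cnj (\<Sum>a<p. M s $$ (l, a) * f a))"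
      using that(3,4) M unfolding cnj_sum sum_product
      by (simp add: index_kraus_map[where p = p] outer_def sum_distrib_left mult_ac)
    ultimately show ?thesis using that by (simp add: outer_def)
  qed
  have single: "(\<Sum>c<p. h c * (if c = b then 1 else 0)) = h b" if "b < p" for h :: "nat \<Rightarrow> complex" and b
    using that by (simp add: if_distrib cong: if_cong)
  \<comment> \<open>With input e_b, the output entry (a, a) is 0; it is also the sum over s of the
    squared moduli of the entries (a, b).\<close>
  have off: "M s $$ (a, b) = 0" if "s \<in> S" "a < p" "b < p" "a \<noteq> b" for s a b
    using pure[of b "\<lambda>c. if c = b then 1 else 0" a a] that
    by (intro sum_mult_cnj_eq_0[OF S, of "\<lambda>s. M s $$ (a, b)"]) (simp_all add: single)
  have diag: "M s $$ (a, a) = M s $$ (b, b)" if "s \<in> S" "a < p" "b < p" for s a b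
  proof (cases "a = b")
    case False
    let ?f = "\<lambda>c. if c = a \<or> c = b then 1 else 0 :: complex"
    have y: "(\<Sum>c<p. M s $$ (k, c) * ?f c) = M s $$ (k, k)" if "s \<in> S" "k = a \<or> k = b" for k s
    proof -
      have "(\<Sum>c<p. M s $$ (k, c) * ?f c) = (\<Sum>c<p. M s $$ (k, c) * (if c = k then 1 else 0))"
        using that \<open>a < p\<close> \<open>b < p\<close> off[of s k] by (intro sum.cong refl) auto
      then show ?thesis using that \<open>a < p\<close> \<open>b < p\<close> single[of k "\<lambda>c. M s $$ (k, c)"] by auto
    qed
    have "(\<Sum>s\<in>S. M s $$ (k, k) * cnj (M s $$ (l, l))) = 1" if "k = a \<or> k = b" "l = a \<or> l = b" for k l
    proof -
      have "(\<Sum>s\<in>S. (\<Sum>c<p. M s $$ (k, c) * ?f c) * cnj (\<Sum>c<p. M s $$ (l, c) * ?f c)) = 1"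
        using pure[of a ?f k l] \<open>a < p\<close> \<open>b < p\<close> that by auto
      moreover have "(\<Sum>s\<in>S. (\<Sum>c<p. M s $$ (k, c) * ?f c) * cnj (\<Sum>c<p. M s $$ (l, c) * ?f c)) =
          (\<Sum>s\<in>S. M s $$ (k, k) * cnj (M s $$ (l, l)))"
        by (intro sum.cong refl) (simp only: y that)
      ultimately show ?thesis by simp
    qed
    \<comment> \<open>Expanding the squared modulus and inserting the four sums just computed gives
      1 - 1 - 1 + 1.\<close>
    then have "(\<Sum>s\<in>S. (M s $$ (a, a) - M s $$ (b, b)) * cnj (M s $$ (a, a) - M s $$ (b, b))) = 0"
      by (simp add: algebra_simps sum.distrib sum_subtractf)
    from sum_mult_cnj_eq_0[OF S this that(1)] show ?thesis by simp
  qed simp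
  show thesis
  proof (rule that[of "\<lambda>s. M s $$ (0, 0)"])
    show "M s = M s $$ (0, 0) \<cdot>\<^sub>m 1\<^sub>m p" if s: "s \<in> S" for s
    proof (rule eq_matI)
      fix i j assume "i < dim_row (M s $$ (0, 0) \<cdot>\<^sub>m 1\<^sub>m p)" "j < dim_col (M s $$ (0, 0) \<cdot>\<^sub>m 1\<^sub>m p)"
      then have ij: "i < p" "j < p" by auto
      show "M s $$ (i, j) = (M s $$ (0, 0) \<cdot>\<^sub>m 1\<^sub>m p) $$ (i, j)"
        using diag[OF s ij(1) p] off[OF s ij] ij by (cases "i = j") simp_all
    qed (use carrier_matD[OF M[OF s]] in auto)
    show "(\<Sum>s\<in>S. M s $$ (0, 0) * cnj (M s $$ (0, 0))) = 1"
      using pure[of 0 "\<lambda>c. if c = 0 then 1 else 0" 0 0] p by (simp add: single)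
  qed
qed

section \<open>Composition, scaling and duality of Kraus maps\<close>

lemma kraus_map_comp:
  assumes K: "\<And>s. s \<in> S \<Longrightarrow> K s \<in> carrier_mat q p" and L: "\<And>t. t \<in> T \<Longrightarrow> L t \<in> carrier_mat r q"
    and X: "X \<in> carrier_mat p p"
  shows "kraus_map r L T (kraus_map q K S X) = kraus_map r (\<lambda>(t, s). L t * K s) (T \<times> S) X"
proof -
  note dK = carrier_matD[OF K] and dL = carrier_matD[OF L] and dX = carrier_matD[OF X]
  have KX: "K s * X * mat_adjoint (K s) \<in> carrier_mat q q" if "s \<in> S" for s
    using dK[OF that] dX by (intro carrier_matI) auto
  have LKX: "L t * (K s * X * mat_adjoint (K s)) \<in> carrier_mat r q" if "t \<in> T" "s \<in> S" for t s
    using dL[OF that(1)] dK[OF that(2)] by (intro carrier_matI) auto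
  have "L t * kraus_map q K S X * mat_adjoint (L t) =
      mat_sum r r (\<lambda>s. (L t * K s) * X * mat_adjoint (L t * K s)) S" if "t \<in> T" for t
  proof -
    have "L t * kraus_map q K S X * mat_adjoint (L t) =
        mat_sum r r (\<lambda>s. L t * (K s * X * mat_adjoint (K s)) * mat_adjoint (L t)) S"
      unfolding kraus_map_def using L[OF that]
      by (simp add: mat_mult_mat_sum[where F = "\<lambda>s. K s * X * mat_adjoint (K s)", OF L[OF that] KX]
        mat_sum_mult[where F = "\<lambda>s. L t * (K s * X * mat_adjoint (K s))", OF _ LKX[OF that]])
    also have "\<dots> = mat_sum r r (\<lambda>s. (L t * K s) * X * mat_adjoint (L t * K s)) S"
      using dL[OF that] dK dX by (intro mat_sum_cong) (simp add: mat_mult_assoc mat_adjoint_mult)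
    finally show ?thesis .
  qed
  then have "kraus_map r L T (kraus_map q K S X) =
      mat_sum r r (\<lambda>t. mat_sum r r (\<lambda>s. (L t * K s) * X * mat_adjoint (L t * K s)) S) T"
    unfolding kraus_map_def[of r L T] by (intro mat_sum_cong)
  also have "\<dots> = kraus_map r (\<lambda>(t, s). L t * K s) (T \<times> S) X"
    by (auto simp: kraus_map_def mat_sum_def sum.cartesian_product split_def intro!: eq_matI)
  finally show ?thesis .
qed

lemma kraus_map_smult:
  assumes "\<And>s. s \<in> S \<Longrightarrow> K s \<in> carrier_mat q p" "X \<in> carrier_mat p p"
  shows "kraus_map q (\<lambda>s. c \<cdot>\<^sub>m K s) S X = (c * cnj c) \<cdot>\<^sub>m kraus_map q K S X"
proof -
  have "(c \<cdot>\<^sub>m K s) * X * mat_adjoint (c \<cdot>\<^sub>m K s) = (c * cnj c) \<cdot>\<^sub>m (K s * X * mat_adjoint (K s))"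
    if "s \<in> S" for s
    using carrier_matD[OF assms(1)[OF that]] carrier_matD[OF assms(2)]
    by (simp add: mat_adjoint_smult mat_mult_smult smult_smult_mat mult.commute)
  then have "kraus_map q (\<lambda>s. c \<cdot>\<^sub>m K s) S X =
      mat_sum q q (\<lambda>s. (c * cnj c) \<cdot>\<^sub>m (K s * X * mat_adjoint (K s))) S"
    unfolding kraus_map_def by (intro mat_sum_cong)
  also have "\<dots> = (c * cnj c) \<cdot>\<^sub>m kraus_map q K S X"
    unfolding kraus_map_def
    by (intro smult_mat_sum[symmetric] carrier_matI) (use carrier_matD[OF assms(1)] in auto)
  finally show ?thesis .
qed

text \<open>Converse to \<open>kraus_identity_scalar\<close>: it evaluates a composite as soon as
  all products of Kraus operators are known to be scalar, whatever the scalars are.\<close>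

lemma kraus_map_scalar:
  assumes "\<And>s. s \<in> S \<Longrightarrow> M s = l s \<cdot>\<^sub>m 1\<^sub>m p" "X \<in> carrier_mat p p"
  shows "kraus_map p M S X = (\<Sum>s\<in>S. l s * cnj (l s)) \<cdot>\<^sub>m X"
proof -
  have "kraus_map p M S X = mat_sum p p (\<lambda>s. (l s * cnj (l s)) \<cdot>\<^sub>m X) S"
    unfolding kraus_map_def
  proof (rule mat_sum_cong)
    fix s assume "s \<in> S"
    then show "M s * X * mat_adjoint (M s) = (l s * cnj (l s)) \<cdot>\<^sub>m X"
      using assms carrier_matD[OF assms(2)]
      by (simp add: mat_adjoint_smult mat_mult_smult smult_smult_mat mult.commute)
  qed
  then show ?thesis using assms(2) by (simp add: mat_sum_scalar)
qed

text \<open>The adjoint operators are Kraus operators of the dual map E^* for the pairing Tr(Y X);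
  cyclicity of the trace moves each K_s across.\<close>

lemma trace_kraus_map_adjoint:
  assumes K: "\<And>s. s \<in> S \<Longrightarrow> K s \<in> carrier_mat q p"
    and X: "X \<in> carrier_mat p p" and Y: "Y \<in> carrier_mat q q"
  shows "trace_mat (Y * kraus_map q K S X) = trace_mat (kraus_map p (\<lambda>s. mat_adjoint (K s)) S Y * X)"
proof -
  note dK = carrier_matD[OF K] and dX = carrier_matD[OF X] and dY = carrier_matD[OF Y]
  have KX: "K s * X * mat_adjoint (K s) \<in> carrier_mat q q" if "s \<in> S" for s
    using dK[OF that] dX by (intro carrier_matI) auto
  have KY: "mat_adjoint (K s) * Y * mat_adjoint (mat_adjoint (K s)) \<in> carrier_mat p p" if "s \<in> S" for s
    using dK[OF that] dY by (intro carrier_matI) auto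
  have "trace_mat (Y * kraus_map q K S X) = (\<Sum>s\<in>S. trace_mat (Y * (K s * X * mat_adjoint (K s))))"
    unfolding kraus_map_def
    by (subst mat_mult_mat_sum[OF Y], erule KX)
      (use dK dY in \<open>intro trace_mat_mat_sum carrier_matI; auto\<close>)
  also have "\<dots> = (\<Sum>s\<in>S. trace_mat (mat_adjoint (K s) * Y * mat_adjoint (mat_adjoint (K s)) * X))"
  proof (rule sum.cong)
    fix s assume s: "s \<in> S"
    have "trace_mat (Y * (K s * X * mat_adjoint (K s))) = trace_mat ((Y * K s * X) * mat_adjoint (K s))"
      using dK[OF s] dX dY by (simp add: mat_mult_assoc)
    also have "\<dots> = trace_mat (mat_adjoint (K s) * (Y * K s * X))"
      using dK[OF s] dX dY by (intro trace_mat_comm) auto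
    also have "mat_adjoint (K s) * (Y * K s * X) = mat_adjoint (K s) * Y * mat_adjoint (mat_adjoint (K s)) * X"
      using dK[OF s] dX dY by (simp add: mat_mult_assoc)
    finally show "trace_mat (Y * (K s * X * mat_adjoint (K s))) =
      trace_mat (mat_adjoint (K s) * Y * mat_adjoint (mat_adjoint (K s)) * X)" .
  qed simp
  also have "\<dots> = trace_mat (kraus_map p (\<lambda>s. mat_adjoint (K s)) S Y * X)"
    unfolding kraus_map_def
    by (subst mat_sum_mult[OF X], erule KY)
      (use dK dX in \<open>intro trace_mat_mat_sum[symmetric] carrier_matI; auto\<close>)
  finally show ?thesis .
qed

text \<open>Duality with the identity gives Tr E(X) = Tr(E^*(1) X), so trace preservation of E means
  that E^* is unital.\<close>

lemma trace_preserving_kraus_map_iff: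
  assumes K: "\<And>s. s \<in> S \<Longrightarrow> K s \<in> carrier_mat q p"
  shows "trace_preserving p (kraus_map q K S) \<longleftrightarrow> kraus_map p (\<lambda>s. mat_adjoint (K s)) S (1\<^sub>m q) = 1\<^sub>m p"
proof -
  have tr: "trace_mat (kraus_map q K S X) = trace_mat (kraus_map p (\<lambda>s. mat_adjoint (K s)) S (1\<^sub>m q) * X)"
    if "X \<in> carrier_mat p p" for X
    using trace_kraus_map_adjoint[where K = K and S = S, OF K that, of "1\<^sub>m q"]
    by (simp add: left_mult_one_mat[where nr = q and nc = q])
  show ?thesis
  proof
    assume tp: "trace_preserving p (kraus_map q K S)"
    show "kraus_map p (\<lambda>s. mat_adjoint (K s)) S (1\<^sub>m q) = 1\<^sub>m p"
    proof (rule eq_mat_if_trace_eq)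
      fix \<rho> assume "density_matrix p \<rho>"
      then have "\<rho> \<in> carrier_mat p p" by (rule density_matrix_carrier)
      then show "trace_mat (kraus_map p (\<lambda>s. mat_adjoint (K s)) S (1\<^sub>m q) * \<rho>) = trace_mat (1\<^sub>m p * \<rho>)"
        using tp tr by (simp add: trace_preserving_def)
    qed auto
  next
    assume "kraus_map p (\<lambda>s. mat_adjoint (K s)) S (1\<^sub>m q) = 1\<^sub>m p"
    then show "trace_preserving p (kraus_map q K S)"
      using tr by (simp add: trace_preserving_def)
  qed
qed

lemma psd_adjoint:
  assumes "psd d Q"
  shows "mat_adjoint Q = Q"
proof -
  have Q: "Q \<in> carrier_mat d d" "0 \<le> quad_form d (\<lambda>i j. Q $$ (i, j)) f" for f
    using assms by (auto simp: psd_iff_quad_form)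
  show ?thesis
    using carrier_matD[OF Q(1)]
    by (intro eq_matI) (auto intro: quad_form_nonneg_hermitian[OF Q(2), symmetric])
qed

text \<open>Since Q is Hermitian, the operators K_s^* Q are Kraus operators of Y |-> E^*(Q Y Q).
  This identifies the left side of the trace condition as a pairing with that map.\<close>

lemma trace_conjugated_kraus_map:
  assumes K: "\<And>s. s \<in> S \<Longrightarrow> K s \<in> carrier_mat q p" and Q: "psd q Q"
    and Y: "Y \<in> carrier_mat q q" and X: "X \<in> carrier_mat p p"
  shows "trace_mat (Q * Y * Q * kraus_map q K S X) =
    trace_mat (kraus_map p (\<lambda>s. mat_adjoint (K s) * Q) S Y * X)"
proof -
  have Qc: "Q \<in> carrier_mat q q" using Q by (simp add: psd_def)
  note d = carrier_matD[OF K] carrier_matD[OF Qc] carrier_matD[OF Y]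
  have "kraus_map p (\<lambda>s. mat_adjoint (K s)) S (Q * Y * Q) = kraus_map p (\<lambda>s. mat_adjoint (K s) * Q) S Y"
    unfolding kraus_map_def
    by (intro mat_sum_cong) (use d in \<open>simp add: mat_adjoint_mult mat_mult_assoc psd_adjoint[OF Q]\<close>)
  moreover have "Q * Y * Q \<in> carrier_mat q q" using d by (intro carrier_matI) auto
  ultimately show ?thesis using trace_kraus_map_adjoint[where K = K and S = S, OF K X, of "Q * Y * Q"] by simp
qed

section \<open>Operator families with scalar mutual products\<close>

text \<open>The diagonal entries of R^* R are the squared norms of the columns of R.\<close>

lemma adjoint_mult_self_eq_0:
  fixes R :: "complex mat"
  assumes R: "R \<in> carrier_mat q p" and z: "mat_adjoint R * R = 0\<^sub>m p p"
  shows "R = 0\<^sub>m q p"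
proof (rule eq_matI)
  fix i j assume "i < dim_row (0\<^sub>m q p)" "j < dim_col (0\<^sub>m q p)"
  then have ij: "i < q" "j < p" by auto
  note d = carrier_matD[OF R]
  have "(\<Sum>k<q. R $$ (k, j) * cnj (R $$ (k, j))) = (mat_adjoint R * R) $$ (j, j)"
    using d ij by (simp add: index_mult_sum mult.commute del: index_mult_mat(1))
  then show "R $$ (i, j) = 0\<^sub>m q p $$ (i, j)"
    using sum_mult_cnj_eq_0[of "{..<q}" "\<lambda>k. R $$ (k, j)" i] ij z by simp
qed (use R in auto)

definition scalar_mat :: "nat \<Rightarrow> complex mat \<Rightarrow> bool" where
  "scalar_mat p A \<longleftrightarrow> (\<exists>c. A = c \<cdot>\<^sub>m 1\<^sub>m p)"

lemma scalar_mat_adjoint: "scalar_mat p A \<Longrightarrow> scalar_mat p (mat_adjoint A)"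
  by (auto simp: scalar_mat_def mat_adjoint_smult)

lemma scalar_mat_minus:
  assumes "scalar_mat p A" "scalar_mat p B"
  shows "scalar_mat p (A - B)"
proof -
  have "c \<cdot>\<^sub>m 1\<^sub>m p - d \<cdot>\<^sub>m 1\<^sub>m p = (c - d) \<cdot>\<^sub>m (1\<^sub>m p :: complex mat)" for c d
    by (rule eq_matI) (auto simp: algebra_simps)
  then show ?thesis using assms by (auto simp: scalar_mat_def)
qed

lemma scalar_mat_mult: "scalar_mat p A \<Longrightarrow> scalar_mat p B \<Longrightarrow> scalar_mat p (A * B)"
  by (auto simp: scalar_mat_def mat_mult_smult mat_mult_one smult_smult_mat)

lemma scalar_mat_smult: "scalar_mat p A \<Longrightarrow> scalar_mat p (c \<cdot>\<^sub>m A)"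
  by (auto simp: scalar_mat_def smult_smult_mat)

lemma scalar_mat_mat_sum:
  assumes "\<And>s. s \<in> S \<Longrightarrow> scalar_mat p (F s)"
  shows "scalar_mat p (mat_sum p p F S)"
proof -
  obtain c where "\<And>s. s \<in> S \<Longrightarrow> F s = c s \<cdot>\<^sub>m 1\<^sub>m p"
    using assms unfolding scalar_mat_def by metis
  then have "mat_sum p p F S = mat_sum p p (\<lambda>s. c s \<cdot>\<^sub>m 1\<^sub>m p) S"
    by (rule mat_sum_cong)
  then show ?thesis by (auto simp: scalar_mat_def mat_sum_scalar)
qed

section \<open>Isometries with orthogonal ranges\<close>

text \<open>For a family as in \<open>orthonormal_ops\<close> this is the orthogonal projection onto
  the sum of the ranges of the \<open>U a\<close>.\<close>

definition range_proj :: "nat \<Rightarrow> (nat \<Rightarrow> complex mat) \<Rightarrow> nat \<Rightarrow> complex mat" where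
  "range_proj q U n = mat_sum q q (\<lambda>a. U a * mat_adjoint (U a)) {..<n}"

text \<open>These are isometries from C^p into C^q whose ranges are mutually orthogonal.\<close>

definition orthonormal_ops :: "nat \<Rightarrow> nat \<Rightarrow> (nat \<Rightarrow> complex mat) \<Rightarrow> nat \<Rightarrow> bool" where
  "orthonormal_ops p q U n \<longleftrightarrow> (\<forall>a<n. U a \<in> carrier_mat q p) \<and>
     (\<forall>a<n. \<forall>b<n. mat_adjoint (U a) * U b = (if a = b then 1\<^sub>m p else 0\<^sub>m p p))"

lemma range_proj_carrier [simp]:
  "range_proj q U n \<in> carrier_mat q q"
  "dim_row (range_proj q U n) = q" "dim_col (range_proj q U n) = q"
  by (simp_all add: range_proj_def)

lemma range_proj_adjoint:
  assumes "\<And>a. a < n \<Longrightarrow> U a \<in> carrier_mat q p"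
  shows "mat_adjoint (range_proj q U n) = range_proj q U n"
proof -
  have "mat_adjoint (range_proj q U n) =
      mat_sum q q (\<lambda>a. mat_adjoint (U a * mat_adjoint (U a))) {..<n}"
    unfolding range_proj_def
    by (intro mat_adjoint_mat_sum carrier_matI) (use carrier_matD[OF assms] in auto)
  also have "\<dots> = range_proj q U n"
    unfolding range_proj_def by (intro mat_sum_cong) (simp add: mat_adjoint_mult)
  finally show ?thesis .
qed

lemma range_proj_mult:
  assumes "\<And>a. a < n \<Longrightarrow> U a \<in> carrier_mat q p" "M \<in> carrier_mat q r"
  shows "range_proj q U n * M = mat_sum q r (\<lambda>a. U a * (mat_adjoint (U a) * M)) {..<n}"
proof -
  have "range_proj q U n * M = mat_sum q r (\<lambda>a. (U a * mat_adjoint (U a)) * M) {..<n}"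
    unfolding range_proj_def
    by (intro mat_sum_mult assms carrier_matI) (use carrier_matD[OF assms(1)] in auto)
  also have "\<dots> = mat_sum q r (\<lambda>a. U a * (mat_adjoint (U a) * M)) {..<n}"
    by (intro mat_sum_cong mat_mult_assoc) (use carrier_matD[OF assms(1)] carrier_matD[OF assms(2)] in auto)
  finally show ?thesis .
qed

lemma range_proj_ops:
  assumes U: "orthonormal_ops p q U n" and b: "b < n"
  shows "range_proj q U n * U b = U b"
proof -
  have Uc: "U a \<in> carrier_mat q p" if "a < n" for a
    using U that by (simp add: orthonormal_ops_def)
  have "range_proj q U n * U b = mat_sum q p (\<lambda>a. U a * (mat_adjoint (U a) * U b)) {..<n}"
    by (rule range_proj_mult[OF Uc Uc[OF b]])
  also have "\<dots> = mat_sum q p (\<lambda>a. (if a = b then 1 else 0) \<cdot>\<^sub>m U b) {..<n}"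
  proof (rule mat_sum_cong)
    fix a assume "a \<in> {..<n}"
    then show "U a * (mat_adjoint (U a) * U b) = (if a = b then 1 else 0) \<cdot>\<^sub>m U b"
      using U b carrier_matD[OF Uc] by (auto simp: orthonormal_ops_def intro!: eq_matI)
  qed
  also have "\<dots> = U b"
    using b carrier_matD[OF Uc[OF b]] by (subst mat_sum_scalar[OF Uc[OF b]]) (auto intro!: eq_matI)
  finally show ?thesis .
qed

lemma range_proj_idem:
  assumes U: "orthonormal_ops p q U n"
  shows "range_proj q U n * range_proj q U n = range_proj q U n"
proof -
  let ?P = "range_proj q U n"
  have Uc: "U a \<in> carrier_mat q p" if "a < n" for a
    using U that by (simp add: orthonormal_ops_def)
  have "?P * ?P = mat_sum q q (\<lambda>a. ?P * (U a * mat_adjoint (U a))) {..<n}"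
    by (subst (2) range_proj_def, rule mat_mult_mat_sum)
      (auto intro!: carrier_matI simp: carrier_matD[OF Uc])
  also have "\<dots> = ?P"
  proof (subst range_proj_def, rule mat_sum_cong)
    fix a assume a: "a \<in> {..<n}"
    have "?P * (U a * mat_adjoint (U a)) = (?P * U a) * mat_adjoint (U a)"
      using a carrier_matD[OF Uc] by (simp add: mat_mult_assoc)
    then show "?P * (U a * mat_adjoint (U a)) = U a * mat_adjoint (U a)"
      using range_proj_ops[OF U] a by simp
  qed
  finally show ?thesis .
qed

text \<open>Gram-Schmidt for families whose mutual products \<open>K s\<^sup>* K t\<close> are scalar. The last conclusion
  replaces the statement that the \<open>U a\<close> lie in the span of the \<open>K s\<close>.\<close>

lemma orthonormal_ops_exist:
  fixes r :: nat
  assumes p: "p > 0"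
    and "\<And>s. s < r \<Longrightarrow> K s \<in> carrier_mat q p"
    and "\<And>s t. s < r \<Longrightarrow> t < r \<Longrightarrow> scalar_mat p (mat_adjoint (K s) * K t)"
  shows "\<exists>n U. orthonormal_ops p q U n \<and> (\<forall>s<r. range_proj q U n * K s = K s) \<and>
    (\<forall>M \<in> carrier_mat q p. (\<forall>s<r. scalar_mat p (mat_adjoint (K s) * M)) \<longrightarrow>
      (\<forall>a<n. scalar_mat p (mat_adjoint (U a) * M)))"
  using assms(2,3)
proof (induction r)
  case 0
  show ?case by (rule exI[of _ 0]) (simp add: orthonormal_ops_def)
next
  case (Suc r)
  obtain n U where U: "orthonormal_ops p q U n" and PK: "\<And>s. s < r \<Longrightarrow> range_proj q U n * K s = K s"
    and span: "\<And>M a. M \<in> carrier_mat q p \<Longrightarrow> \<forall>s<r. scalar_mat p (mat_adjoint (K s) * M) \<Longrightarrow>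
      a < n \<Longrightarrow> scalar_mat p (mat_adjoint (U a) * M)"
    using Suc.IH[OF Suc.prems(1) Suc.prems(2)] by (auto simp: less_Suc_eq)
  define P where "P = range_proj q U n"
  \<comment> \<open>The part of \<open>K r\<close> orthogonal to the ranges found so far; it is the
    next isometry up to scale, unless it vanishes.\<close>
  define R where "R = K r - P * K r"
  have Uc: "U a \<in> carrier_mat q p" if "a < n" for a
    using U that by (simp add: orthonormal_ops_def)
  have dK: "dim_row (K s) = q" "dim_col (K s) = p" if "s < Suc r" for s
    using carrier_matD[OF Suc.prems(1)[OF that]] by auto
  have dU: "dim_row (U a) = q" "dim_col (U a) = p" if "a < n" for a
    using carrier_matD[OF Uc[OF that]] by auto
  have dP: "dim_row P = q" "dim_col P = q" by (simp_all add: P_def)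
  have dR: "dim_row R = q" "dim_col R = p" by (simp_all add: R_def dK dP)
  then have Rc: "R \<in> carrier_mat q p" by (rule carrier_matI)
  have adjP: "mat_adjoint P = P" unfolding P_def by (rule range_proj_adjoint[OF Uc])
  have PP: "P * P = P" unfolding P_def by (rule range_proj_idem[OF U])
  have PR: "P * R = 0\<^sub>m q p"
  proof -
    have "P * R = P * K r - (P * P) * K r"
      unfolding R_def by (simp add: mat_mult_minus mat_mult_assoc dK dP)
    then show ?thesis using dK[of r] dP by (intro eq_matI) (simp_all add: PP)
  qed
  have adjRP: "mat_adjoint R * P = 0\<^sub>m p q"
  proof -
    have "mat_adjoint R * P = mat_adjoint (P * R)"
      by (simp add: mat_adjoint_mult dP dR adjP)
    also have "\<dots> = 0\<^sub>m p q" unfolding PR by (rule eq_matI) auto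
    finally show ?thesis .
  qed
  have adjR_K: "mat_adjoint R * K s = 0\<^sub>m p p" if "s < r" for s
  proof -
    have "mat_adjoint R * K s = mat_adjoint R * P * K s"
      using PK[OF that] that by (simp add: mat_mult_assoc dP dR dK P_def)
    also have "\<dots> = 0\<^sub>m p p"
      unfolding adjRP using dK[of s] that by simp
    finally show ?thesis .
  qed
  have U_R: "mat_adjoint (U a) * R = 0\<^sub>m p p" if "a < n" for a
  proof -
    have "U a = P * U a" using range_proj_ops[OF U that] by (simp add: P_def)
    then have "mat_adjoint (U a) = mat_adjoint (U a) * P"
      by (metis adjP dP(2) dU(1) mat_adjoint_mult that)
    then have "mat_adjoint (U a) * R = mat_adjoint (U a) * (P * R)"
      by (metis dP dR(1) dU(1) dim_mat_adjoint(2) mat_mult_assoc that)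
    then show ?thesis using dU[OF that] by (simp add: PR)
  qed
  \<comment> \<open>R^* M equals K_r^* M minus the sum over a of (K_r^* U_a)(U_a^* M), and each
    factor is scalar. For K_r^* U_a this comes from the induction hypothesis with M = K_r, after
    taking adjoints.\<close>
  have R_span: "scalar_mat p (mat_adjoint R * M)"
    if M: "M \<in> carrier_mat q p" "\<And>s. s < Suc r \<Longrightarrow> scalar_mat p (mat_adjoint (K s) * M)" for M
  proof -
    note dM = carrier_matD[OF M(1)]
    have UK: "scalar_mat p (mat_adjoint (K r) * U a)" if "a < n" for a
    proof -
      have "scalar_mat p (mat_adjoint (U a) * K r)"
        using span[OF Suc.prems(1)[of r] _ that] Suc.prems(2) by simp
      from scalar_mat_adjoint[OF this] show ?thesis
        using dU[OF that] dK[of r] by (simp add: mat_adjoint_mult)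
    qed
    have UM: "scalar_mat p (mat_adjoint (U a) * M)" if "a < n" for a
      using span[OF M(1) _ that] M(2) by simp
    have "mat_adjoint (K r) * (P * M) =
        mat_sum p p (\<lambda>a. mat_adjoint (K r) * (U a * (mat_adjoint (U a) * M))) {..<n}"
      unfolding P_def
      by (subst range_proj_mult[OF _ M(1)], erule Uc, rule mat_mult_mat_sum)
        (auto intro!: carrier_matI simp: dU dK dM)
    also have "\<dots> = mat_sum p p (\<lambda>a. (mat_adjoint (K r) * U a) * (mat_adjoint (U a) * M)) {..<n}"
      by (intro mat_sum_cong) (simp add: mat_mult_assoc dU dK dM)
    finally have PM: "mat_adjoint (K r) * (P * M) =
        mat_sum p p (\<lambda>a. (mat_adjoint (K r) * U a) * (mat_adjoint (U a) * M)) {..<n}" .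
    have "scalar_mat p (mat_adjoint (K r) * (P * M))"
      unfolding PM by (intro scalar_mat_mat_sum scalar_mat_mult[OF UK UM]) auto
    moreover have "mat_adjoint R * M = mat_adjoint (K r) * M - mat_adjoint (K r) * (P * M)"
      unfolding R_def using dK[of r] dP dM
      by (simp add: mat_adjoint_minus mat_adjoint_mult adjP mat_mult_minus mat_mult_assoc)
    ultimately show ?thesis using M(2)[of r] by (simp add: scalar_mat_minus)
  qed
  have K_eq: "K r = R + P * K r"
    unfolding R_def by (intro eq_matI) (auto simp: dK dP)
  have adjR_Kr: "mat_adjoint R * K r = mat_adjoint R * R"
  proof -
    have "mat_adjoint R * R = mat_adjoint R * K r - mat_adjoint R * P * K r"
      by (subst (2) R_def) (simp add: mat_mult_minus mat_mult_assoc dK dP dR)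
    then show ?thesis
      unfolding adjRP by (intro eq_matI) (auto simp: dK dR)
  qed
  have "scalar_mat p (mat_adjoint R * K r)"
    using R_span[OF Suc.prems(1)[of r]] Suc.prems(2) by simp
  then obtain c where c: "mat_adjoint R * R = c \<cdot>\<^sub>m 1\<^sub>m p"
    by (auto simp: scalar_mat_def adjR_Kr)
  show ?case
  proof (cases "c = 0")
    \<comment> \<open>Here \<open>K r\<close> already maps into the ranges of the
      \<open>U a\<close>, so the family is kept as it is.\<close>
    case True
    then have "R = 0\<^sub>m q p"
      using c by (intro adjoint_mult_self_eq_0[OF Rc]) (auto intro!: eq_matI)
    then have "P * K r = K r"
      using K_eq dK[of r] dP by (metis left_add_zero_mat mult_carrier_mat carrier_matI lessI)
    then have "range_proj q U n * K s = K s" if "s < Suc r" for s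
      using PK that by (auto simp: P_def less_Suc_eq)
    then show ?thesis
      using U span by (intro exI[of _ n] exI[of _ U]) auto
  next
    case False
    \<comment> \<open>The constant c is the squared norm of column 0 of R, which exists because p >
      0. Hence c is a positive real and R / sqrt c is an isometry.\<close>
    define N where "N = (\<Sum>k<q. (cmod (R $$ (k, 0)))\<^sup>2)"
    have "c = (mat_adjoint R * R) $$ (0, 0)" using c p by simp
    also have "\<dots> = complex_of_real N"
      using dR p by (simp add: index_mult_sum N_def complex_norm_square mult.commute
          del: index_mult_mat(1) of_real_power)
    finally have cN: "c = complex_of_real N" .
    have "N \<ge> 0" by (simp add: N_def sum_nonneg)
    with False cN have N: "N > 0" by (cases "N = 0") auto
    define k where "k = complex_of_real (1 / sqrt N)"
    have kk: "k * k * c = 1" "cnj k = k"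
      using N by (simp_all add: k_def cN flip: of_real_mult of_real_divide)
    define V where "V = U(n := k \<cdot>\<^sub>m R)"
    have V: "V a = (if a = n then k \<cdot>\<^sub>m R else U a)" for a
      by (simp add: V_def)
    have nn: "mat_adjoint (k \<cdot>\<^sub>m R) * (k \<cdot>\<^sub>m R) = 1\<^sub>m p"
    proof -
      have "mat_adjoint (k \<cdot>\<^sub>m R) * (k \<cdot>\<^sub>m R) = (k * k) \<cdot>\<^sub>m (mat_adjoint R * R)"
        by (simp add: mat_adjoint_smult mat_mult_smult smult_smult_mat kk)
      then show ?thesis unfolding c smult_smult_mat kk by (auto intro!: eq_matI)
    qed
    have Un: "mat_adjoint (U a) * (k \<cdot>\<^sub>m R) = 0\<^sub>m p p" if "a < n" for a
      using U_R[OF that] dU[OF that] dR by (simp add: mat_mult_smult)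
    have nU: "mat_adjoint (k \<cdot>\<^sub>m R) * U a = 0\<^sub>m p p" if "a < n" for a
    proof -
      have "mat_adjoint (k \<cdot>\<^sub>m R) * U a = mat_adjoint (mat_adjoint (U a) * (k \<cdot>\<^sub>m R))"
        using dU[OF that] dR by (simp add: mat_adjoint_mult)
      then show ?thesis unfolding Un[OF that] by (auto intro!: eq_matI)
    qed
    have orth: "orthonormal_ops p q V (Suc n)"
      using U Rc nn Un nU by (auto simp: orthonormal_ops_def V less_Suc_eq)
    have P': "range_proj q V (Suc n) = P + k \<cdot>\<^sub>m R * mat_adjoint (k \<cdot>\<^sub>m R)"
    proof (rule eq_matI)
      fix i j assume "i < dim_row (P + k \<cdot>\<^sub>m R * mat_adjoint (k \<cdot>\<^sub>m R))"
        "j < dim_col (P + k \<cdot>\<^sub>m R * mat_adjoint (k \<cdot>\<^sub>m R))"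
      then have ij: "i < q" "j < q" using dR by auto
      have "(\<Sum>s<n. (V s * mat_adjoint (V s)) $$ (i, j)) = (\<Sum>s<n. (U s * mat_adjoint (U s)) $$ (i, j))"
        by (intro sum.cong) (auto simp: V)
      then show "range_proj q V (Suc n) $$ (i, j) = (P + k \<cdot>\<^sub>m R * mat_adjoint (k \<cdot>\<^sub>m R)) $$ (i, j)"
        using ij dR by (simp add: range_proj_def mat_sum_def P_def V del: index_mult_mat(1))
    qed (simp_all add: dR)
    \<comment> \<open>The new projection adds only R (R^* K_s) / c. For s < r this correction
      vanishes, and for s = r it restores exactly the part R that P removes from
      \<open>K r\<close>.\<close>
    have P'K: "range_proj q V (Suc n) * K s = P * K s + (k * k) \<cdot>\<^sub>m (R * (mat_adjoint R * K s))"
      if "s < Suc r" for s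
    proof -
      have "range_proj q V (Suc n) * K s = P * K s + (k \<cdot>\<^sub>m R * mat_adjoint (k \<cdot>\<^sub>m R)) * K s"
        unfolding P' using dP dR dK[OF that]
        by (intro add_mult_distrib_mat[of _ q q _ _ p] carrier_matI) auto
      then show ?thesis
        using dR dK[OF that] by (simp add: mat_adjoint_smult mat_mult_smult smult_smult_mat kk mat_mult_assoc)
    qed
    have "range_proj q V (Suc n) * K s = K s" if "s < Suc r" for s
    proof (cases "s = r")
      case True
      have "(k * k) \<cdot>\<^sub>m (R * (mat_adjoint R * K r)) = (k * k * c) \<cdot>\<^sub>m R"
        unfolding adjR_Kr c using dR by (simp add: mat_mult_smult smult_smult_mat mat_mult_one)
      also have "\<dots> = R" unfolding kk by (auto intro!: eq_matI)
      finally have "range_proj q V (Suc n) * K r = P * K r + R"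
        using P'K[of r] by simp
      also have "\<dots> = K r"
        unfolding R_def by (intro eq_matI) (auto simp: dK dP)
      finally show ?thesis using True by simp
    next
      case False
      then have "s < r" using that by simp
      then have "range_proj q V (Suc n) * K s = K s + (k * k) \<cdot>\<^sub>m 0\<^sub>m q p"
        using P'K[OF that] PK[of s] adjR_K[of s] dR by (simp add: P_def right_mult_zero_mat[OF Rc])
      then show ?thesis using right_add_zero_mat[OF Suc.prems(1)[OF that]] by simp
    qed
    moreover have "scalar_mat p (mat_adjoint (V a) * M)"
      if M: "M \<in> carrier_mat q p" "\<forall>s<Suc r. scalar_mat p (mat_adjoint (K s) * M)" "a < Suc n" for M a
    proof (cases "a = n")
      case True
      then have "mat_adjoint (V a) * M = cnj k \<cdot>\<^sub>m (mat_adjoint R * M)"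
        using carrier_matD[OF M(1)] dR by (simp add: V mat_adjoint_smult mat_mult_smult)
      then show ?thesis using R_span[OF M(1)] M(2) by (simp add: scalar_mat_smult)
    next
      case False
      then show ?thesis using span[OF M(1)] M by (simp add: V)
    qed
    ultimately show ?thesis
      using orth by (intro exI[of _ "Suc n"] exI[of _ V]) blast
  qed
qed

section \<open>Inverses of completely positive maps\<close>

text \<open>\<open>kraus_identity_scalar\<close> is applied to the products indexed by pairs. The
  sum over t is put inside because, for fixed s, it will reappear as the diagonal Gram coefficient
  \<open>g (s, s)\<close>.\<close>

lemma kraus_inverse_products_scalar:
  assumes p: "p > 0" and S: "finite S" and T: "finite T"
    and K: "\<And>s. s \<in> S \<Longrightarrow> K s \<in> carrier_mat q p" and L: "\<And>t. t \<in> T \<Longrightarrow> L t \<in> carrier_mat p q"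
    and inv: "inverts p (kraus_map p L T) (kraus_map q K S)"
  obtains l where "\<And>t s. t \<in> T \<Longrightarrow> s \<in> S \<Longrightarrow> L t * K s = l t s \<cdot>\<^sub>m 1\<^sub>m p"
    "(\<Sum>s\<in>S. \<Sum>t\<in>T. l t s * cnj (l t s)) = 1"
proof -
  have LK: "(case ts of (t, s) \<Rightarrow> L t * K s) \<in> carrier_mat p p" if "ts \<in> T \<times> S" for ts
    using that K L by (auto intro: mult_carrier_mat)
  have "kraus_map p (\<lambda>(t, s). L t * K s) (T \<times> S) \<rho> = \<rho>" if "density_matrix p \<rho>" for \<rho>
    using kraus_map_comp[where K = K and L = L and S = S and T = T, OF K L density_matrix_carrier[OF that]]
      inv that by (simp add: inverts_def)
  from kraus_identity_scalar[OF p finite_cartesian_product[OF T S] LK this]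
  obtain l where l: "\<And>ts. ts \<in> T \<times> S \<Longrightarrow> (case ts of (t, s) \<Rightarrow> L t * K s) = l ts \<cdot>\<^sub>m 1\<^sub>m p"
    "(\<Sum>ts\<in>T \<times> S. l ts * cnj (l ts)) = 1"
    by blast
  have "(\<Sum>s\<in>S. \<Sum>t\<in>T. l (t, s) * cnj (l (t, s))) = 1"
    unfolding l(2)[symmetric] by (subst sum.swap) (simp add: sum.cartesian_product split_def)
  then show thesis using that[of "\<lambda>t s. l (t, s)"] l(1) by auto
qed

lemma kraus_inverse_imp_trace_condition:
  assumes p: "p > 0" and S: "finite S" and T: "finite T"
    and K: "\<And>s. s \<in> S \<Longrightarrow> K s \<in> carrier_mat q p" and L: "\<And>t. t \<in> T \<Longrightarrow> L t \<in> carrier_mat p q"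
    and inv: "inverts p (kraus_map p L T) (kraus_map q K S)"
    and Q: "Q = kraus_map q (\<lambda>t. mat_adjoint (L t)) T (1\<^sub>m p)"
  shows "psd q Q" and "\<exists>c::real. c > 0 \<and> (\<forall>\<rho> \<sigma>. density_matrix p \<rho> \<longrightarrow> density_matrix p \<sigma> \<longrightarrow>
    trace_mat (Q * kraus_map q K S \<rho> * Q * kraus_map q K S \<sigma>) = complex_of_real c * trace_mat (\<rho> * \<sigma>))"
proof -
  have L': "mat_adjoint (L t) \<in> carrier_mat q p" if "t \<in> T" for t
    using L[OF that] by simp
  show psdQ: "psd q Q"
    unfolding Q kraus_map_def by (intro psd_mat_sum psd_congruence[OF psd_one] L')
  obtain l where l: "\<And>t s. t \<in> T \<Longrightarrow> s \<in> S \<Longrightarrow> L t * K s = l t s \<cdot>\<^sub>m 1\<^sub>m p"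
    and l1: "(\<Sum>s\<in>S. \<Sum>t\<in>T. l t s * cnj (l t s)) = 1"
    using kraus_inverse_products_scalar[OF p S T K L inv] by blast
  note dK = carrier_matD[OF K] and dL = carrier_matD[OF L]
  \<comment> \<open>The scalar in K_u^* Q K_s: inserting Q = D^*(1) gives the sum over t of the
    adjoint of L_t K_u times L_t K_s.\<close>
  define g where "g = (\<lambda>(u, s). \<Sum>t\<in>T. cnj (l t u) * l t s)"
  have gram: "mat_adjoint (K u) * Q * K s = g (u, s) \<cdot>\<^sub>m 1\<^sub>m p" if us: "u \<in> S" "s \<in> S" for u s
  proof -
    have LL: "mat_adjoint (L t) * 1\<^sub>m p * mat_adjoint (mat_adjoint (L t)) \<in> carrier_mat q q" if "t \<in> T" for t
      using dL[OF that] by (intro carrier_matI) auto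
    have KLL: "mat_adjoint (K u) * (mat_adjoint (L t) * 1\<^sub>m p * mat_adjoint (mat_adjoint (L t))) \<in> carrier_mat p q"
      if "t \<in> T" for t
      using dL[OF that] dK[OF us(1)] by (intro carrier_matI) auto
    have Ku: "mat_adjoint (K u) \<in> carrier_mat p q"
      using K[OF us(1)] by simp
    have "mat_adjoint (K u) * Q * K s =
        mat_sum p p (\<lambda>t. mat_adjoint (K u) * (mat_adjoint (L t) * 1\<^sub>m p * mat_adjoint (mat_adjoint (L t))) * K s) T"
      unfolding Q kraus_map_def
      by (subst mat_mult_mat_sum[OF Ku], erule LL, rule mat_sum_mult[OF K[OF us(2)]], erule KLL)
    also have "\<dots> = mat_sum p p (\<lambda>t. (cnj (l t u) * l t s) \<cdot>\<^sub>m 1\<^sub>m p) T"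
    proof (rule mat_sum_cong)
      fix t assume t: "t \<in> T"
      have "mat_adjoint (K u) * (mat_adjoint (L t) * 1\<^sub>m p * mat_adjoint (mat_adjoint (L t))) * K s =
          mat_adjoint (L t * K u) * (L t * K s)"
        using dK[OF us(1)] dK[OF us(2)] dL[OF t]
        by (simp add: mat_adjoint_mult mat_mult_assoc mat_mult_one)
      then show "mat_adjoint (K u) * (mat_adjoint (L t) * 1\<^sub>m p * mat_adjoint (mat_adjoint (L t))) * K s =
          (cnj (l t u) * l t s) \<cdot>\<^sub>m 1\<^sub>m p"
        using l[OF t us(1)] l[OF t us(2)]
        by (simp add: mat_adjoint_smult mat_mult_smult mat_mult_one smult_smult_mat mult.commute)
    qed
    finally show ?thesis by (simp add: mat_sum_scalar g_def)
  qed
  \<comment> \<open>The map sending \<rho> to E^*(Q E(\<rho>) Q) has the Kraus operators K_u^* Q K_s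
    = g(u,s) 1, so it multiplies \<rho> by this number.\<close>
  define c where "c = (\<Sum>us\<in>S \<times> S. (cmod (g us))\<^sup>2)"
  have Qc: "Q \<in> carrier_mat q q" using psdQ by (simp add: psd_def)
  have KQ: "mat_adjoint (K u) * Q \<in> carrier_mat p q" if "u \<in> S" for u
    using K[OF that] Qc by (intro mult_carrier_mat) auto
  have "kraus_map p (\<lambda>u. mat_adjoint (K u) * Q) S (kraus_map q K S \<rho>) = complex_of_real c \<cdot>\<^sub>m \<rho>"
    if "\<rho> \<in> carrier_mat p p" for \<rho>
  proof -
    have "kraus_map p (\<lambda>u. mat_adjoint (K u) * Q) S (kraus_map q K S \<rho>) =
        kraus_map p (\<lambda>(u, s). mat_adjoint (K u) * Q * K s) (S \<times> S) \<rho>"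
      by (rule kraus_map_comp[OF K KQ that])
    also have "\<dots> = (\<Sum>us\<in>S \<times> S. g us * cnj (g us)) \<cdot>\<^sub>m \<rho>"
      using gram by (intro kraus_map_scalar[OF _ that]) auto
    also have "(\<Sum>us\<in>S \<times> S. g us * cnj (g us)) = complex_of_real c"
      by (simp add: c_def complex_norm_square del: of_real_power)
    finally show ?thesis .
  qed
  then have "trace_mat (Q * kraus_map q K S \<rho> * Q * kraus_map q K S \<sigma>) = complex_of_real c * trace_mat (\<rho> * \<sigma>)"
    if "\<rho> \<in> carrier_mat p p" "\<sigma> \<in> carrier_mat p p" for \<rho> \<sigma>
    using trace_conjugated_kraus_map[where K = K and S = S, OF K psdQ _ that(2), of "kraus_map q K S \<rho>"]
      that carrier_matD[OF that(1)] carrier_matD[OF that(2)]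
    by (simp add: mat_mult_smult trace_mat_smult)
  moreover have "c > 0"
  proof (rule ccontr)
    assume "\<not> c > 0"
    moreover have "c \<ge> 0" unfolding c_def by (intro sum_nonneg) simp
    ultimately have "(\<Sum>us\<in>S \<times> S. (cmod (g us))\<^sup>2) = 0" by (simp add: c_def)
    \<comment> \<open>The diagonal coefficients are sums of squared moduli of the
      \<open>l t s\<close>, and these add up to 1 over all t and s, so they cannot all
      vanish.\<close>
    then have "g (s, s) = 0" if "s \<in> S" for s
      using S that by (subst (asm) sum_nonneg_eq_0_iff) auto
    then have "(\<Sum>t\<in>T. l t s * cnj (l t s)) = 0" if "s \<in> S" for s
      using that by (simp add: g_def mult.commute)
    with l1 show False by simp
  qed
  ultimately show "\<exists>c::real. c > 0 \<and> (\<forall>\<rho> \<sigma>. density_matrix p \<rho> \<longrightarrow> density_matrix p \<sigma> \<longrightarrow>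
    trace_mat (Q * kraus_map q K S \<rho> * Q * kraus_map q K S \<sigma>) = complex_of_real c * trace_mat (\<rho> * \<sigma>))"
    by (meson density_matrix_carrier)
qed

text \<open>Pairing with all states \<sigma> identifies E^*(Q E(\<rho>) Q) with c \<rho>. The factor
  1 / sqrt c on each Kraus operator divides the map by c.\<close>

lemma trace_condition_imp_kraus_inverse:
  assumes K: "\<And>s. s \<in> S \<Longrightarrow> K s \<in> carrier_mat q p" and Q: "psd q Q" and c: "c > 0"
    and tr: "\<And>\<rho> \<sigma>. density_matrix p \<rho> \<Longrightarrow> density_matrix p \<sigma> \<Longrightarrow>
      trace_mat (Q * kraus_map q K S \<rho> * Q * kraus_map q K S \<sigma>) = complex_of_real c * trace_mat (\<rho> * \<sigma>)"
  shows "inverts p (kraus_map p (\<lambda>s. complex_of_real (1 / sqrt c) \<cdot>\<^sub>m (mat_adjoint (K s) * Q)) S) (kraus_map q K S)"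
  unfolding inverts_def
proof (intro allI impI)
  fix \<rho> assume \<rho>: "density_matrix p \<rho>"
  note \<rho>c = density_matrix_carrier[OF \<rho>]
  let ?D = "kraus_map p (\<lambda>s. mat_adjoint (K s) * Q) S (kraus_map q K S \<rho>)"
  let ?k = "complex_of_real (1 / sqrt c)"
  have Qc: "Q \<in> carrier_mat q q" using Q by (simp add: psd_def)
  have KQ: "mat_adjoint (K u) * Q \<in> carrier_mat p q" if "u \<in> S" for u
    using K[OF that] Qc by (intro mult_carrier_mat) auto
  have "?D = complex_of_real c \<cdot>\<^sub>m \<rho>"
  proof (rule eq_mat_if_trace_eq)
    fix \<sigma> assume \<sigma>: "density_matrix p \<sigma>"
    note \<sigma>c = density_matrix_carrier[OF \<sigma>]
    show "trace_mat (?D * \<sigma>) = trace_mat (complex_of_real c \<cdot>\<^sub>m \<rho> * \<sigma>)"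
      using trace_conjugated_kraus_map[where K = K and S = S, OF K Q _ \<sigma>c, of "kraus_map q K S \<rho>"] tr[OF \<rho> \<sigma>]
        carrier_matD[OF \<rho>c] carrier_matD[OF \<sigma>c]
      by (simp add: mat_mult_smult trace_mat_smult)
  qed (use \<rho>c in auto)
  moreover have "kraus_map p (\<lambda>s. ?k \<cdot>\<^sub>m (mat_adjoint (K s) * Q)) S (kraus_map q K S \<rho>) = (?k * cnj ?k) \<cdot>\<^sub>m ?D"
    by (rule kraus_map_smult[OF KQ]) auto
  moreover have "?k * cnj ?k * complex_of_real c = 1"
    using c by (simp flip: of_real_mult of_real_divide)
  ultimately show "kraus_map p (\<lambda>s. ?k \<cdot>\<^sub>m (mat_adjoint (K s) * Q)) S (kraus_map q K S \<rho>) = \<rho>"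
    by (simp only: smult_smult_mat) (auto intro!: eq_matI)
qed

section \<open>The recovery map\<close>

text \<open>For p > 0 these are Kraus operators of the map that replaces every input Y by Tr(Y)
  times the projection onto e_0.\<close>

definition sink_op :: "nat \<Rightarrow> nat \<Rightarrow> nat \<Rightarrow> complex mat" where
  "sink_op p q m = mat p q (\<lambda>(i, j). if i = 0 \<and> j = m then 1 else 0)"

lemma sink_op_carrier [simp]:
  "sink_op p q m \<in> carrier_mat p q" "dim_row (sink_op p q m) = p" "dim_col (sink_op p q m) = q"
  by (simp_all add: sink_op_def)

lemma sum_sink_op:
  assumes "p > 0"
  shows "mat_sum q q (\<lambda>m. mat_adjoint (sink_op p q m) * sink_op p q m) {..<q} = 1\<^sub>m q"
proof (rule eq_matI)
  fix i j assume "i < dim_row (1\<^sub>m q)" "j < dim_col (1\<^sub>m q)"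
  then have ij: "i < q" "j < q" by auto
  have "(mat_adjoint (sink_op p q m) * sink_op p q m) $$ (i, j) = (if m = i then if i = j then 1 else 0 else 0)" for m
  proof -
    have "(mat_adjoint (sink_op p q m) * sink_op p q m) $$ (i, j) =
        (\<Sum>k<p. mat_adjoint (sink_op p q m) $$ (i, k) * sink_op p q m $$ (k, j))"
      using ij by (simp add: index_mult_sum del: index_mult_mat(1))
    also have "\<dots> = (\<Sum>k<p. if k = 0 then if m = i \<and> i = j then 1 else 0 else 0)"
      by (intro sum.cong refl) (use ij in \<open>auto simp: sink_op_def\<close>)
    finally have "(mat_adjoint (sink_op p q m) * sink_op p q m) $$ (i, j) =
        (\<Sum>k<p. if k = 0 then if m = i \<and> i = j then 1 else 0 else 0)" .
    then show ?thesis using assms by simp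
  qed
  then show "mat_sum q q (\<lambda>m. mat_adjoint (sink_op p q m) * sink_op p q m) {..<q} $$ (i, j) = 1\<^sub>m q $$ (i, j)"
    using ij by (simp add: mat_sum_def del: index_mult_mat(1))
qed auto

text \<open>\<open>Inl a\<close> undoes the isometry \<open>U a\<close>; the operators \<open>Inr m\<close> send everything orthogonal to the
  ranges of the \<open>U a\<close> to the state \<open>e\<^sub>0\<close>, which makes the recovery map trace preserving.\<close>

definition recovery_op :: "nat \<Rightarrow> nat \<Rightarrow> (nat \<Rightarrow> complex mat) \<Rightarrow> nat \<Rightarrow> nat + nat \<Rightarrow> complex mat" where
  "recovery_op p q U n x = (case x of Inl a \<Rightarrow> mat_adjoint (U a)
     | Inr m \<Rightarrow> sink_op p q m * (1\<^sub>m q - range_proj q U n))"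

lemma recovery_op_carrier:
  assumes "orthonormal_ops p q U n" "x \<in> {..<n} <+> {..<q}"
  shows "recovery_op p q U n x \<in> carrier_mat p q"
  using assms
  by (auto simp: recovery_op_def orthonormal_ops_def intro!: mult_carrier_mat[of _ p q] minus_carrier_mat)

text \<open>Unitality of the dual map: the \<open>Inl\<close> operators contribute the projection P
  onto the ranges, and the \<open>Inr\<close> operators contribute (1 - P) 1 (1 - P) = 1 - P by
  \<open>sum_sink_op\<close>.\<close>

lemma trace_preserving_recovery:
  assumes p: "p > 0" and U: "orthonormal_ops p q U n"
  shows "trace_preserving q (kraus_map p (recovery_op p q U n) ({..<n} <+> {..<q}))"
proof (subst trace_preserving_kraus_map_iff)
  let ?V = "recovery_op p q U n"
  let ?P = "range_proj q U n"
  let ?C = "1\<^sub>m q - ?P"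
  have Uc: "U a \<in> carrier_mat q p" if "a < n" for a
    using U that by (simp add: orthonormal_ops_def)
  have Cadj: "mat_adjoint ?C = ?C"
    by (simp add: mat_adjoint_minus range_proj_adjoint[OF Uc])
  have CC: "?C * ?C = ?C"
  proof -
    have "?C * ?C = ?C - (?P - ?P * ?P)"
      by (simp add: mat_mult_minus mat_mult_one)
    then show ?thesis unfolding range_proj_idem[OF U] by (auto intro!: eq_matI)
  qed
  have "mat_sum q q (\<lambda>m. mat_adjoint (?V (Inr m)) * 1\<^sub>m p * mat_adjoint (mat_adjoint (?V (Inr m)))) {..<q} =
      mat_sum q q (\<lambda>m. ?C * (mat_adjoint (sink_op p q m) * sink_op p q m) * ?C) {..<q}"
    by (intro mat_sum_cong) (simp add: recovery_op_def mat_adjoint_mult Cadj mat_mult_assoc mat_mult_one)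
  also have "\<dots> = ?C * mat_sum q q (\<lambda>m. mat_adjoint (sink_op p q m) * sink_op p q m) {..<q} * ?C"
    by (subst mat_mult_mat_sum[where k = q and m = q and n = q]; (subst mat_sum_mult[where k = q])?)
      (auto intro!: carrier_matI)
  also have "\<dots> = ?C"
    by (simp add: sum_sink_op[OF p] mat_mult_one CC)
  finally have right: "mat_sum q q (\<lambda>m. mat_adjoint (?V (Inr m)) * 1\<^sub>m p * mat_adjoint (mat_adjoint (?V (Inr m)))) {..<q} = ?C" .
  have left: "mat_sum q q (\<lambda>a. mat_adjoint (?V (Inl a)) * 1\<^sub>m p * mat_adjoint (mat_adjoint (?V (Inl a)))) {..<n} = ?P"
    unfolding range_proj_def
    by (intro mat_sum_cong) (simp add: recovery_op_def mat_mult_one carrier_matD[OF Uc])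
  have "kraus_map q (\<lambda>x. mat_adjoint (?V x)) ({..<n} <+> {..<q}) (1\<^sub>m p) =
      mat_sum q q (\<lambda>a. mat_adjoint (?V (Inl a)) * 1\<^sub>m p * mat_adjoint (mat_adjoint (?V (Inl a)))) {..<n} +
      mat_sum q q (\<lambda>m. mat_adjoint (?V (Inr m)) * 1\<^sub>m p * mat_adjoint (mat_adjoint (?V (Inr m)))) {..<q}"
    by (rule eq_matI)
      (simp_all add: kraus_map_def mat_sum_def sum.Plus
        del: index_mult_mat(1))
  also have "\<dots> = 1\<^sub>m q"
    unfolding left right by (auto intro!: eq_matI)
  finally show "kraus_map q (\<lambda>x. mat_adjoint (?V x)) ({..<n} <+> {..<q}) (1\<^sub>m p) = 1\<^sub>m q" .
qed (rule recovery_op_carrier[OF U])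

text \<open>A map and its Kraus form agree only on the carrier; this passes the inverse property
  between them.\<close>

lemma inverts_cong:
  assumes "\<And>X. X \<in> carrier_mat p p \<Longrightarrow> E X = E' X" "\<And>X. X \<in> carrier_mat p p \<Longrightarrow> E' X \<in> carrier_mat q q"
    "\<And>Y. Y \<in> carrier_mat q q \<Longrightarrow> D Y = D' Y"
  shows "inverts p D E \<longleftrightarrow> inverts p D' E'"
  using assms by (auto simp: inverts_def density_matrix_carrier)

lemma trace_condition_imp_cptp_kraus_inverse:
  fixes K :: "nat \<Rightarrow> complex mat"
  assumes p: "p > 0" and K: "\<And>s. s < r \<Longrightarrow> K s \<in> carrier_mat q p"
    and tp: "trace_preserving p (kraus_map q K {..<r})" and c: "c > 0"
    and tr: "\<And>\<rho> \<sigma>. density_matrix p \<rho> \<Longrightarrow> density_matrix p \<sigma> \<Longrightarrow>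
      trace_mat (kraus_map q K {..<r} \<rho> * kraus_map q K {..<r} \<sigma>) = complex_of_real c * trace_mat (\<rho> * \<sigma>)"
  shows "\<exists>D. cptp q p D \<and> inverts p D (kraus_map q K {..<r})"
proof -
  let ?E = "kraus_map q K {..<r}"
  let ?k = "complex_of_real (1 / sqrt c)"
  have Kc: "K s \<in> carrier_mat q p" if "s \<in> {..<r}" for s using K that by simp
  note dK = carrier_matD[OF K]
  \<comment> \<open>The CP inverse E^* / c, the case Q = 1. It serves to show that all K_t^* K_s are
    scalar, which is the input for Gram-Schmidt.\<close>
  define L where "L = (\<lambda>s. ?k \<cdot>\<^sub>m (mat_adjoint (K s) * 1\<^sub>m q))"
  have Lc: "L s \<in> carrier_mat p q" if "s \<in> {..<r}" for s
    using dK[of s] that unfolding L_def by (intro carrier_matI) auto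
  have inv: "inverts p (kraus_map p L {..<r}) ?E"
    unfolding L_def
    by (rule trace_condition_imp_kraus_inverse[OF Kc psd_one c]) (simp_all add: tr mat_mult_one)
  obtain l where l: "\<And>t s. t \<in> {..<r} \<Longrightarrow> s \<in> {..<r} \<Longrightarrow> L t * K s = l t s \<cdot>\<^sub>m 1\<^sub>m p"
    by (rule kraus_inverse_products_scalar[OF p finite_lessThan finite_lessThan _ _ inv])
      (erule Kc, erule Lc, erule that)
  have scal: "scalar_mat p (mat_adjoint (K t) * K s)" if "t < r" "s < r" for t s
  proof -
    have "?k \<cdot>\<^sub>m (mat_adjoint (K t) * K s) = l t s \<cdot>\<^sub>m 1\<^sub>m p"
      using l[of t s] that dK[OF that(1)] dK[OF that(2)]
      by (simp add: L_def mat_mult_smult mat_mult_one)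
    then have "complex_of_real (sqrt c) \<cdot>\<^sub>m (?k \<cdot>\<^sub>m (mat_adjoint (K t) * K s)) =
        (complex_of_real (sqrt c) * l t s) \<cdot>\<^sub>m 1\<^sub>m p"
      by (simp add: smult_smult_mat)
    moreover have "complex_of_real (sqrt c) * ?k = 1" using c by simp
    ultimately have "1 \<cdot>\<^sub>m (mat_adjoint (K t) * K s) = (complex_of_real (sqrt c) * l t s) \<cdot>\<^sub>m 1\<^sub>m p"
      by (simp only: smult_smult_mat)
    moreover have "1 \<cdot>\<^sub>m A = A" for A :: "complex mat" by (auto intro!: eq_matI)
    ultimately show ?thesis by (auto simp: scalar_mat_def)
  qed
  obtain n U where U: "orthonormal_ops p q U n" and PK: "\<And>s. s < r \<Longrightarrow> range_proj q U n * K s = K s"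
    and span: "\<And>M a. M \<in> carrier_mat q p \<Longrightarrow> \<forall>s<r. scalar_mat p (mat_adjoint (K s) * M) \<Longrightarrow>
      a < n \<Longrightarrow> scalar_mat p (mat_adjoint (U a) * M)"
    using orthonormal_ops_exist[where r = r and K = K, OF p K scal] by (metis (no_types, lifting))
  let ?T = "{..<n} <+> {..<q} :: (nat + nat) set"
  let ?V = "recovery_op p q U n"
  let ?D = "kraus_map p ?V ?T"
  note Vc = recovery_op_carrier[OF U]
  have Dtp: "trace_preserving q ?D" by (rule trace_preserving_recovery[OF p U])
  \<comment> \<open>For U_a^* K_s this is the last conclusion of
    \<open>orthonormal_ops_exist\<close> with M = K_s. The sink operators annihilate K_s, because P
    K_s = K_s.\<close>
  have "scalar_mat p (?V x * K s)" if "x \<in> ?T" "s < r" for x s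
  proof (cases x)
    case (Inl a)
    then show ?thesis using span[OF K[OF that(2)], of a] scal that by (auto simp: recovery_op_def)
  next
    case (Inr m)
    have "?V x * K s = sink_op p q m * (K s - range_proj q U n * K s)"
      using Inr dK[OF that(2)] by (simp add: recovery_op_def mat_mult_assoc mat_mult_minus mat_mult_one)
    also have "\<dots> = 0 \<cdot>\<^sub>m 1\<^sub>m p"
      unfolding PK[OF that(2)] using dK[OF that(2)] by (auto intro!: eq_matI simp: scalar_prod_def)
    finally show ?thesis by (auto simp: scalar_mat_def)
  qed
  then obtain v where v: "\<And>x s. x \<in> ?T \<Longrightarrow> s < r \<Longrightarrow> ?V x * K s = v x s \<cdot>\<^sub>m 1\<^sub>m p"
    unfolding scalar_mat_def by metis
  define w where "w = (\<Sum>(x, s)\<in>?T \<times> {..<r}. v x s * cnj (v x s))"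
  have DE: "?D (?E \<rho>) = w \<cdot>\<^sub>m \<rho>" if "\<rho> \<in> carrier_mat p p" for \<rho>
  proof -
    have "?D (?E \<rho>) = kraus_map p (\<lambda>(x, s). ?V x * K s) (?T \<times> {..<r}) \<rho>"
      by (rule kraus_map_comp[OF Kc Vc that])
    also have "\<dots> = (\<Sum>xs\<in>?T \<times> {..<r}. case_prod v xs * cnj (case_prod v xs)) \<cdot>\<^sub>m \<rho>"
      by (rule kraus_map_scalar[OF _ that]) (auto simp only: mem_Times_iff split_def lessThan_iff intro!: v)
    finally show ?thesis by (simp add: w_def split_def)
  qed
  have "?D (?E \<rho>) = \<rho>" if "density_matrix p \<rho>" for \<rho>
  proof -
    note \<rho> = density_matrix_carrier[OF that]
    have "trace_mat (?D (?E \<rho>)) = trace_mat \<rho>"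
      using Dtp tp \<rho> by (simp add: trace_preserving_def)
    \<comment> \<open>A state has trace 1, and both maps preserve the trace, so the factor w cannot
      change it.\<close>
    then have "w = 1"
      using that carrier_matD[OF \<rho>] by (simp add: DE[OF \<rho>] trace_mat_smult density_matrix_def)
    then show ?thesis unfolding DE[OF \<rho>] by (auto intro!: eq_matI)
  qed
  then show ?thesis
    using Dtp completely_positive_kraus_map[where K = ?V and S = ?T, OF Vc]
    by (intro exI[of _ ?D]) (auto simp: cptp_def inverts_def)
qed

section \<open>From Kraus families back to arbitrary maps\<close>

text \<open>The third conclusion lets one statement serve both equivalences: Q = D^*(1) is the
  identity when D preserves the trace.\<close>

lemma cp_inverse_imp_trace_condition:
  assumes p: "p > 0" and E: "completely_positive p q E" and D: "completely_positive q p D"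
    and inv: "inverts p D E"
  obtains Q and c :: real where "psd q Q" "c > 0" "trace_preserving q D \<Longrightarrow> Q = 1\<^sub>m q"
    "\<And>\<rho> \<sigma>. density_matrix p \<rho> \<Longrightarrow> density_matrix p \<sigma> \<Longrightarrow>
      trace_mat (Q * E \<rho> * Q * E \<sigma>) = complex_of_real c * trace_mat (\<rho> * \<sigma>)"
proof -
  obtain r :: nat and K where K: "\<And>s. s < r \<Longrightarrow> K s \<in> carrier_mat q p"
    and EK: "\<And>X. X \<in> carrier_mat p p \<Longrightarrow> E X = kraus_map q K {..<r} X"
    using completely_positive_imp_kraus[OF E] by blast
  obtain r' :: nat and L where L: "\<And>s. s < r' \<Longrightarrow> L s \<in> carrier_mat p q"
    and DL: "\<And>Y. Y \<in> carrier_mat q q \<Longrightarrow> D Y = kraus_map p L {..<r'} Y"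
    using completely_positive_imp_kraus[OF D] by blast
  have Kc: "K s \<in> carrier_mat q p" if "s \<in> {..<r}" for s using K that by simp
  have Lc: "L s \<in> carrier_mat p q" if "s \<in> {..<r'}" for s using L that by simp
  have inv': "inverts p (kraus_map p L {..<r'}) (kraus_map q K {..<r})"
    using inv EK DL by (subst (asm) inverts_cong[where q = q]) auto
  define Q where "Q = kraus_map q (\<lambda>t. mat_adjoint (L t)) {..<r'} (1\<^sub>m p)"
  note Q = kraus_inverse_imp_trace_condition[OF p finite_lessThan finite_lessThan Kc Lc inv' Q_def]
  have "Q = 1\<^sub>m q" if "trace_preserving q D"
  proof -
    have "trace_preserving q (kraus_map p L {..<r'})"
      using that DL by (simp add: trace_preserving_def)
    then show ?thesis
      unfolding Q_def by (subst (asm) trace_preserving_kraus_map_iff[OF Lc])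
  qed
  with Q show thesis
    using that[of Q] by (metis EK density_matrix_carrier)
qed

lemma trace_condition_imp_cp_inverse:
  assumes E: "completely_positive p q E" and Q: "psd q Q" and c: "c > 0"
    and tr: "\<And>\<rho> \<sigma>. density_matrix p \<rho> \<Longrightarrow> density_matrix p \<sigma> \<Longrightarrow>
      trace_mat (Q * E \<rho> * Q * E \<sigma>) = complex_of_real c * trace_mat (\<rho> * \<sigma>)"
  shows "\<exists>D. completely_positive q p D \<and> inverts p D E"
proof -
  obtain r :: nat and K where K: "\<And>s. s < r \<Longrightarrow> K s \<in> carrier_mat q p"
    and EK: "\<And>X. X \<in> carrier_mat p p \<Longrightarrow> E X = kraus_map q K {..<r} X"
    using completely_positive_imp_kraus[OF E] by blast
  have Kc: "K s \<in> carrier_mat q p" if "s \<in> {..<r}" for s using K that by simp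
  let ?L = "\<lambda>s. complex_of_real (1 / sqrt c) \<cdot>\<^sub>m (mat_adjoint (K s) * Q)"
  have Lc: "?L s \<in> carrier_mat p q" if "s \<in> {..<r}" for s
    using Kc[OF that] Q by (simp add: psd_def)
  have "inverts p (kraus_map p ?L {..<r}) (kraus_map q K {..<r})"
    by (rule trace_condition_imp_kraus_inverse[OF Kc Q c]) (use tr in \<open>auto simp: EK density_matrix_carrier\<close>)
  then have "inverts p (kraus_map p ?L {..<r}) E"
    by (subst inverts_cong[where q = q, OF EK]) auto
  then show ?thesis using completely_positive_kraus_map[where K = ?L and S = "{..<r}", OF Lc] by blast
qed

lemma trace_condition_imp_cptp_inverse:
  assumes p: "p > 0" and E: "cptp p q E" and c: "c > 0"
    and tr: "\<And>\<rho> \<sigma>. density_matrix p \<rho> \<Longrightarrow> density_matrix p \<sigma> \<Longrightarrow>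
      trace_mat (E \<rho> * E \<sigma>) = complex_of_real c * trace_mat (\<rho> * \<sigma>)"
  shows "\<exists>D. cptp q p D \<and> inverts p D E"
proof -
  obtain r :: nat and K where K: "\<And>s. s < r \<Longrightarrow> K s \<in> carrier_mat q p"
    and EK: "\<And>X. X \<in> carrier_mat p p \<Longrightarrow> E X = kraus_map q K {..<r} X"
    using completely_positive_imp_kraus E unfolding cptp_def by blast
  have "trace_preserving p (kraus_map q K {..<r})"
    using E EK by (simp add: cptp_def trace_preserving_def)
  from trace_condition_imp_cptp_kraus_inverse[OF p K this c]
  obtain D where "cptp q p D" "inverts p D (kraus_map q K {..<r})"
    using tr EK density_matrix_carrier by metis
  then show ?thesis
    by (intro exI[of _ D]) (simp add: inverts_def EK density_matrix_carrier)
qed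

theorem theorem2p2:
  fixes p q :: nat
  assumes "p > 0" and "q > 0"
  shows
    "(\<forall>E. completely_positive p q E \<longrightarrow>
        ((\<exists>D. completely_positive q p D \<and> inverts p D E) \<longleftrightarrow>
         (\<exists>Q. \<exists>c::real. psd q Q \<and> c > 0 \<and>
            (\<forall>\<rho> \<sigma>. density_matrix p \<rho> \<longrightarrow> density_matrix p \<sigma> \<longrightarrow>
               trace_mat (Q * E \<rho> * Q * E \<sigma>) = complex_of_real c * trace_mat (\<rho> * \<sigma>))))) \<and>
     (\<forall>E. cptp p q E \<longrightarrow>
        ((\<exists>D. cptp q p D \<and> inverts p D E) \<longleftrightarrow>
         (\<exists>c::real. c > 0 \<and>
            (\<forall>\<rho> \<sigma>. density_matrix p \<rho> \<longrightarrow> density_matrix p \<sigma> \<longrightarrow>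
               trace_mat (E \<rho> * E \<sigma>) = complex_of_real c * trace_mat (\<rho> * \<sigma>)))))"
proof -
  have one: "1\<^sub>m q * E \<rho> * 1\<^sub>m q * E \<sigma> = E \<rho> * E \<sigma>"
    if "cptp p q E" "density_matrix p \<rho>" for E \<rho> \<sigma>
  proof -
    have "E \<rho> \<in> carrier_mat q q"
      using that by (auto simp: cptp_def completely_positive_def intro: linear_superopD(1) density_matrix_carrier)
    then show ?thesis by (simp add: mat_mult_one)
  qed
  show ?thesis
  proof (intro conjI allI impI iffI)
    fix E assume E: "completely_positive p q E"
    { assume "\<exists>D. completely_positive q p D \<and> inverts p D E"
      then show "\<exists>Q. \<exists>c::real. psd q Q \<and> c > 0 \<and>
          (\<forall>\<rho> \<sigma>. density_matrix p \<rho> \<longrightarrow> density_matrix p \<sigma> \<longrightarrow>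
             trace_mat (Q * E \<rho> * Q * E \<sigma>) = complex_of_real c * trace_mat (\<rho> * \<sigma>))"
        using cp_inverse_imp_trace_condition[OF assms(1) E] by metis }
    { assume "\<exists>Q. \<exists>c::real. psd q Q \<and> c > 0 \<and>
          (\<forall>\<rho> \<sigma>. density_matrix p \<rho> \<longrightarrow> density_matrix p \<sigma> \<longrightarrow>
             trace_mat (Q * E \<rho> * Q * E \<sigma>) = complex_of_real c * trace_mat (\<rho> * \<sigma>))"
      then show "\<exists>D. completely_positive q p D \<and> inverts p D E"
        using trace_condition_imp_cp_inverse[OF E] by blast }
  next
    fix E assume E: "cptp p q E"
    { assume "\<exists>D. cptp q p D \<and> inverts p D E"
      then obtain D where D: "completely_positive q p D" "trace_preserving q D" "inverts p D E"
        by (auto simp: cptp_def)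
      have "completely_positive p q E" using E by (simp add: cptp_def)
      from cp_inverse_imp_trace_condition[OF assms(1) this D(1,3)] D(2)
      show "\<exists>c::real. c > 0 \<and>
          (\<forall>\<rho> \<sigma>. density_matrix p \<rho> \<longrightarrow> density_matrix p \<sigma> \<longrightarrow>
             trace_mat (E \<rho> * E \<sigma>) = complex_of_real c * trace_mat (\<rho> * \<sigma>))"
        using one[OF E] by metis }
    { assume "\<exists>c::real. c > 0 \<and>
          (\<forall>\<rho> \<sigma>. density_matrix p \<rho> \<longrightarrow> density_matrix p \<sigma> \<longrightarrow>
             trace_mat (E \<rho> * E \<sigma>) = complex_of_real c * trace_mat (\<rho> * \<sigma>))"
      then show "\<exists>D. cptp q p D \<and> inverts p D E"
        using trace_condition_imp_cptp_inverse[OF assms(1) E] by blast }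
  qed
qed

end
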